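(* There exists an absolute constant $c>0$ such that the following holds for all sufficiently large $n$. Let $S_1$ and $S_2$ be collections of closed curves in the plane such that $S_1\cup S_2$ is in general position, $|S_1|=|S_2|=n$, any two elements of $S_1\cup S_2$ intersect, and every element of $S_1$ touches every element of $S_2$. Then the number of crossing points between pairs of elements of $S_1$, or the number of crossing points between pairs of elements of $S_2$, is at least $c\,n^2\sqrt{\log n/\log\log n}$.
   Context: Closed curves are simple closed (Jordan) curves in the plane. A family of curves is in general position if no three curves pass through the same point and no two curves share infinitely many points. Two curves touch if they have precisely one point in common, at which they do not properly cross; this point is a touching point. All other common points of two curves are crossing points. Two curves intersect if they have at least one common point. *)

theory Defs
  imports "HOL-Analysis.Analysis"
begin

text \<open>Curves are point sets in the plane, identified with \<open>complex\<close>.\<close>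

definition closed_curve :: "complex set \<Rightarrow> bool" where
  "closed_curve A \<longleftrightarrow> (\<exists>g. simple_path g \<and> pathfinish g = pathstart g \<and> path_image g = A)"

definition general_position :: "complex set set \<Rightarrow> bool" where
  "general_position S \<longleftrightarrow>
     (\<forall>A\<in>S. \<forall>B\<in>S. \<forall>C\<in>S. A \<noteq> B \<and> A \<noteq> C \<and> B \<noteq> C \<longrightarrow> A \<inter> B \<inter> C = {}) \<and>
     (\<forall>A\<in>S. \<forall>B\<in>S. A \<noteq> B \<longrightarrow> finite (A \<inter> B))"

text \<open>\<open>B\<close> passes at \<open>p\<close> from one side of the Jordan curve \<open>A\<close> to the other. Since \<open>B\<close> is closed,
  it can be parametrized so that \<open>p\<close> is at parameter \<open>1/2\<close>, and the direction of traversal can be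
  reversed, so it suffices to speak of passing from the inside to the outside.\<close>

definition properly_cross_at :: "complex \<Rightarrow> complex set \<Rightarrow> complex set \<Rightarrow> bool" where
  "properly_cross_at p A B \<longleftrightarrow>
     p \<in> A \<inter> B \<and>
     (\<exists>g \<epsilon>. simple_path g \<and> pathfinish g = pathstart g \<and> path_image g = B \<and> g (1/2) = p \<and>
        0 < \<epsilon> \<and> \<epsilon> \<le> 1/2 \<and>
        g ` {1/2 - \<epsilon> <..< 1/2} \<subseteq> inside A \<and> g ` {1/2 <..< 1/2 + \<epsilon>} \<subseteq> outside A)"

definition touching_points :: "complex set \<Rightarrow> complex set \<Rightarrow> complex set" where
  "touching_points A B = {p. A \<inter> B = {p} \<and> \<not> properly_cross_at p A B}"

definition touch :: "complex set \<Rightarrow> complex set \<Rightarrow> bool" where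
  "touch A B \<longleftrightarrow> (\<exists>p. A \<inter> B = {p} \<and> \<not> properly_cross_at p A B)"

definition crossing_points :: "complex set \<Rightarrow> complex set \<Rightarrow> complex set" where
  "crossing_points A B = (A \<inter> B) - touching_points A B"

text \<open>In general position a point lies on at most two of the curves, so counting points is the same
  as counting crossings pair by pair.\<close>

definition crossings :: "complex set set \<Rightarrow> complex set" where
  "crossings S = (\<Union>A\<in>S. \<Union>B\<in>S - {A}. crossing_points A B)"

end

theory Submission
  imports Defs "HOL-Library.Discrete_Functions" "HOL-Real_Asymp.Real_Asymp"
begin

text \<open>
  Two curves with a single common point lie on one side of each other, so cutting the plane along the
  curves of \<open>S1\<close> one crosscut after the other produces a Jordan curve \<open>\<Gamma>\<close> that contains all touching
  points and has the curves of \<open>S2\<close> inside and those of \<open>S1\<close> outside. (Cutting needs two curves of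
  \<open>S1\<close> with two common points; they exist because five curves cannot touch pairwise, which is the
  nonplanarity of the complete graph on five vertices.)

  Read the \<open>n\<^sup>2\<close> touching points along \<open>\<Gamma>\<close>. Chords of \<open>\<Gamma>\<close> on the same side with interlacing end
  points intersect, so two curves of one family whose touching points alternate \<open>k\<close> times have at
  least about \<open>k / 2\<close> common points. It remains to bound the number of alternations in a sequence that
  runs through all pairs in \<open>S1 \<times> S2\<close>. Among any \<open>(2 m)\<^sup>2\<close> consecutive pairs, \<open>2 m\<close> distinct curves of
  one of the families occur, and at least \<open>m\<close> of their first occurrences come after \<open>m\<close> other curves
  have been seen since the previous occurrence. So there are at least \<open>n\<^sup>2 / (8 m)\<close> such positions for
  every \<open>m \<le> n / 2\<close>, and summing over \<open>m\<close> yields order \<open>n\<^sup>2 log n\<close> alternations.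
\<close>

section \<open>Sequences running through all pairs\<close>

text \<open>If \<open>r t\<close> has not occurred before \<open>t\<close>, all earlier entries count as seen.\<close>

definition seen_since :: "(nat \<Rightarrow> 'a) \<Rightarrow> nat \<Rightarrow> 'a set" where
  "seen_since r t = {y. y \<noteq> r t \<and> (\<exists>q<t. r q = y \<and> (\<forall>s. q < s \<and> s < t \<longrightarrow> r s \<noteq> r t))}"

definition long_returns :: "(nat \<Rightarrow> 'a) \<Rightarrow> nat \<Rightarrow> nat set" where
  "long_returns r m = {t. m \<le> card (seen_since r t)}"

definition alternations :: "(nat \<Rightarrow> 'a) \<Rightarrow> nat \<Rightarrow> 'a \<Rightarrow> 'a \<Rightarrow> nat set" where
  "alternations r N x y = {t. t < N \<and> r t = x \<and> y \<in> seen_since r t}"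

lemma seen_since_subset: "seen_since r t \<subseteq> r ` {..<t}"
  by (auto simp: seen_since_def)

lemma finite_seen_since [simp]: "finite (seen_since r t)"
  using seen_since_subset by (rule finite_subset) simp

lemma window_subset_seen_since:
  assumes "r t \<notin> r ` {a..<t}"
  shows "r ` {a..<t} \<subseteq> seen_since r t"
proof
  fix y assume y: "y \<in> r ` {a..<t}"
  then obtain q where q: "a \<le> q" "q < t" "y = r q" by auto
  have "r s \<noteq> r t" if "q < s" "s < t" for s
  proof -
    have "r s \<in> r ` {a..<t}" using that q(1) by simp
    then show ?thesis using assms by metis
  qed
  moreover have "y \<noteq> r t" using y assms by blast
  ultimately show "y \<in> seen_since r t"
    unfolding seen_since_def using q by blast
qed

lemma card_window_le_long_returns:
  assumes "a \<le> e"
  shows "card (r ` {a..<e}) \<le> card ({a..<e} \<inter> long_returns r m) + m"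
  using assms
proof (induction e rule: dec_induct)
  case base
  then show ?case by simp
next
  case (step e)
  have image: "r ` {a..<Suc e} = insert (r e) (r ` {a..<e})"
    using step by (simp add: atLeastLessThanSuc)
  have mono: "card ({a..<e} \<inter> long_returns r m) \<le> card ({a..<Suc e} \<inter> long_returns r m)"
    by (rule card_mono) auto
  show ?case
  proof (cases "r e \<in> r ` {a..<e}")
    case True
    then show ?thesis using image mono step.IH by (simp add: insert_absorb)
  next
    case new: False
    show ?thesis
    proof (cases "m \<le> card (r ` {a..<e})")
      case True
      have "card (r ` {a..<e}) \<le> card (seen_since r e)"
        using window_subset_seen_since[OF new] by (simp add: card_mono)
      then have "e \<in> long_returns r m" using True by (simp add: long_returns_def)
      then have "{a..<Suc e} \<inter> long_returns r m = insert e ({a..<e} \<inter> long_returns r m)"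
        using step by auto
      then show ?thesis using image new step.IH by simp
    next
      case False
      then show ?thesis using image new by simp
    qed
  qed
qed

lemma inj_on_Pair_card_image_ge:
  assumes inj: "inj_on (\<lambda>t. (r t, b t)) T" and "finite T" "k\<^sup>2 \<le> card T"
  shows "k \<le> card (r ` T) \<or> k \<le> card (b ` T)"
proof (rule ccontr)
  assume small: "\<not> ?thesis"
  have "card T = card ((\<lambda>t. (r t, b t)) ` T)"
    using inj by (simp add: card_image)
  also have "\<dots> \<le> card (r ` T \<times> b ` T)"
    using \<open>finite T\<close> by (intro card_mono) auto
  also have "\<dots> < k\<^sup>2"
    unfolding card_cartesian_product power2_eq_square using small by (intro mult_strict_mono) auto
  finally show False using assms(3) by simp
qed

lemma long_returns_of_pairs_ge:
  assumes "inj_on (\<lambda>t. (r t, b t)) {..<N}" and "w * (2 * m)\<^sup>2 \<le> N"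
  shows "m * w \<le> card ({..<N} \<inter> long_returns r m) + card ({..<N} \<inter> long_returns b m)"
  using assms
proof (induction w arbitrary: N)
  case 0
  then show ?case by simp
next
  case (Suc w)
  define a e where "a = w * (2 * m)\<^sup>2" and "e = a + (2 * m)\<^sup>2"
  have "e \<le> N" using Suc.prems(2) by (simp add: a_def e_def)
  have "inj_on (\<lambda>t. (r t, b t)) {a..<e}" "inj_on (\<lambda>t. (r t, b t)) {..<a}"
    using \<open>e \<le> N\<close> by (auto intro: inj_on_subset[OF Suc.prems(1)] simp: e_def)
  then have "2 * m \<le> card (r ` {a..<e}) \<or> 2 * m \<le> card (b ` {a..<e})"
    and before: "m * w \<le> card ({..<a} \<inter> long_returns r m) + card ({..<a} \<inter> long_returns b m)"
    using inj_on_Pair_card_image_ge[of r b "{a..<e}" "2 * m"] Suc.IH[of a]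
    by (simp_all add: e_def a_def)
  then have window: "m \<le> card ({a..<e} \<inter> long_returns r m) + card ({a..<e} \<inter> long_returns b m)"
    using card_window_le_long_returns[of a e r m] card_window_le_long_returns[of a e b m]
    by (auto simp: e_def)
  have split: "card ({..<a} \<inter> L) + card ({a..<e} \<inter> L) \<le> card ({..<N} \<inter> L)" for L :: "nat set"
  proof -
    have "card ({..<a} \<inter> L) + card ({a..<e} \<inter> L) = card (({..<a} \<inter> L) \<union> ({a..<e} \<inter> L))"
      by (rule card_Un_disjoint[symmetric]) auto
    also have "\<dots> \<le> card ({..<N} \<inter> L)"
      using \<open>e \<le> N\<close> by (intro card_mono) (auto simp: e_def)
    finally show ?thesis .
  qed
  show ?case
    using before window split[of "long_returns r m"] split[of "long_returns b m"] by simp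
qed

lemma long_returns_of_pairs_ge_divide:
  assumes inj: "inj_on (\<lambda>t. (r t, b t)) {..<N}" and "m > 0" "(2 * m)\<^sup>2 \<le> N"
  shows "real N / (8 * real m)
    \<le> real (card ({..<N} \<inter> long_returns r m) + card ({..<N} \<inter> long_returns b m))"
proof -
  define w where "w = N div (2 * m)\<^sup>2"
  have "w \<ge> 1"
    unfolding w_def using assms(2,3) by (simp add: div_greater_zero_iff Suc_le_eq)
  have "N < Suc w * (2 * m)\<^sup>2"
    unfolding w_def using assms(2) by (simp add: dividend_less_div_times add.commute)
  also have "\<dots> \<le> (2 * w) * (2 * m)\<^sup>2"
    using \<open>w \<ge> 1\<close> by (intro mult_right_mono) auto
  also have "\<dots> = 8 * m * (m * w)"
    by (simp add: power2_eq_square)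
  finally have "real N \<le> real (8 * m * (m * w))"
    by (simp only: of_nat_le_iff less_imp_le)
  then have "real N / (8 * real m) \<le> real (m * w)"
    using \<open>m > 0\<close> by (simp add: field_simps)
  also have "m * w \<le> card ({..<N} \<inter> long_returns r m) + card ({..<N} \<inter> long_returns b m)"
    by (rule long_returns_of_pairs_ge[OF inj]) (simp add: w_def)
  finally show ?thesis by simp
qed

lemma sum_card_long_returns_le:
  assumes "finite T"
  shows "(\<Sum>m=1..M. card (T \<inter> long_returns r m)) \<le> (\<Sum>t\<in>T. card (seen_since r t))"
proof -
  have "(\<Sum>m=1..M. card (T \<inter> long_returns r m))
      = (\<Sum>t\<in>T. card {m \<in> {1..M}. m \<le> card (seen_since r t)})"
    using sum_multicount_gen[of "{1..M}" T "\<lambda>m t. m \<le> card (seen_since r t)"] assms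
    by (simp add: long_returns_def Int_def)
  also have "\<dots> \<le> (\<Sum>t\<in>T. card {1..card (seen_since r t)})"
    by (intro sum_mono card_mono) auto
  finally show ?thesis by simp
qed

theorem sum_seen_since_of_pairs_ge:
  assumes inj: "inj_on (\<lambda>t. (r t, b t)) {..<N}" and "N > 0"
  shows "real N / 16 * ln (real N / 4)
    \<le> real ((\<Sum>t<N. card (seen_since r t)) + (\<Sum>t<N. card (seen_since b t)))"
proof -
  define M where "M = floor_sqrt N div 2"
  have "N < (Suc (floor_sqrt N))\<^sup>2" by (rule Suc_floor_sqrt_power2_gt)
  also have "\<dots> \<le> (2 * (M + 1))\<^sup>2" unfolding M_def by (intro power_mono) auto
  finally have "real N < real ((2 * (M + 1))\<^sup>2)" by (simp only: of_nat_less_iff)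
  then have "real N / 4 \<le> (real M + 1)\<^sup>2" by (simp add: power2_eq_square algebra_simps)
  then have "ln (real N / 4) \<le> ln ((real M + 1)\<^sup>2)" using \<open>N > 0\<close> by simp
  also have "\<dots> = 2 * ln (real M + 1)" by (simp add: ln_realpow)
  also have "\<dots> \<le> 2 * harm M" using ln_le_harm[of M] by simp
  finally have "real N / 16 * ln (real N / 4) \<le> real N / 16 * (2 * harm M)"
    by (rule mult_left_mono) simp
  also have "\<dots> = (\<Sum>m=1..M. real N / (8 * real m))"
    by (simp add: harm_def sum_distrib_left field_simps)
  also have "\<dots> \<le> (\<Sum>m=1..M. real (card ({..<N} \<inter> long_returns r m)
      + card ({..<N} \<inter> long_returns b m)))"
  proof (rule sum_mono)
    fix m assume "m \<in> {1..M}"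
    then have "m > 0" "2 * m \<le> floor_sqrt N" by (auto simp: M_def)
    then show "real N / (8 * real m)
        \<le> real (card ({..<N} \<inter> long_returns r m) + card ({..<N} \<inter> long_returns b m))"
      by (intro long_returns_of_pairs_ge_divide inj) (auto simp: le_floor_sqrt_iff)
  qed
  also have "\<dots> = real ((\<Sum>m=1..M. card ({..<N} \<inter> long_returns r m))
      + (\<Sum>m=1..M. card ({..<N} \<inter> long_returns b m)))"
    by (simp add: sum.distrib)
  also have "\<dots> \<le> real ((\<Sum>t<N. card (seen_since r t)) + (\<Sum>t<N. card (seen_since b t)))"
    unfolding of_nat_le_iff by (intro add_mono sum_card_long_returns_le) auto
  finally show ?thesis .
qed

lemma sum_card_seen_since_eq_alternations:
  assumes "finite S" and r: "r ` {..<N} \<subseteq> S"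
  shows "(\<Sum>t<N. card (seen_since r t)) = (\<Sum>x\<in>S. \<Sum>y\<in>S - {x}. card (alternations r N x y))"
proof -
  have "(\<Sum>t<N. card (seen_since r t)) = (\<Sum>x\<in>S. \<Sum>t | t \<in> {..<N} \<and> r t = x. card (seen_since r t))"
    by (rule sum.group[symmetric]) (use assms in auto)
  also have "\<dots> = (\<Sum>x\<in>S. \<Sum>y\<in>S - {x}. card (alternations r N x y))"
  proof (rule sum.cong[OF refl])
    fix x
    have "seen_since r t = {y \<in> S - {x}. y \<in> seen_since r t}" if "t < N" "r t = x" for t
      using r that by (auto simp: seen_since_def)
    then have "(\<Sum>t | t \<in> {..<N} \<and> r t = x. card (seen_since r t))
        = (\<Sum>t | t \<in> {..<N} \<and> r t = x. card {y \<in> S - {x}. y \<in> seen_since r t})"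
      by (intro sum.cong) auto
    also have "\<dots> = (\<Sum>y\<in>S - {x}. card (alternations r N x y))"
      using assms(1) by (intro sum_multicount_gen) (auto simp: alternations_def conj_assoc)
    finally show "(\<Sum>t | t \<in> {..<N} \<and> r t = x. card (seen_since r t))
        = (\<Sum>y\<in>S - {x}. card (alternations r N x y))" .
  qed
  finally show ?thesis .
qed

definition extremal_occurrences :: "('a \<Rightarrow> 'a \<Rightarrow> bool) \<Rightarrow> ('a \<Rightarrow> 'b) \<Rightarrow> 'a set \<Rightarrow> 'a set" where
  "extremal_occurrences R f T = {t \<in> T. \<forall>s\<in>T. R s t \<longrightarrow> f s \<noteq> f t}"

lemma card_extremal_occurrences_le:
  assumes "finite T" and total: "\<And>s t. s \<noteq> t \<Longrightarrow> R s t \<or> R t s"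
  shows "card (extremal_occurrences R f T) \<le> card (f ` T)"
proof (rule card_inj_on_le)
  show "inj_on f (extremal_occurrences R f T)"
  proof (rule inj_onI, rule ccontr)
    fix s t
    assume st: "s \<in> extremal_occurrences R f T" "t \<in> extremal_occurrences R f T" "f s = f t" "s \<noteq> t"
    consider "R s t" | "R t s" using total[OF st(4)] by blast
    then show False using st by cases (auto simp: extremal_occurrences_def)
  qed
qed (use assms in \<open>auto simp: extremal_occurrences_def\<close>)

lemma alternations_last_occurrence:
  assumes "t \<in> alternations r N x y"
  obtains q where "q < t" "r q = y" "\<And>s. q < s \<Longrightarrow> s < t \<Longrightarrow> r s \<noteq> x \<and> r s \<noteq> y"
proof -
  obtain q0 where q0: "q0 < t" "r q0 = y" "\<And>s. q0 < s \<Longrightarrow> s < t \<Longrightarrow> r s \<noteq> x"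
    using assms by (auto simp: alternations_def seen_since_def)
  define q where "q = Max {s. s < t \<and> r s = y}"
  have "q \<in> {s. s < t \<and> r s = y}"
    unfolding q_def by (rule Max_in) (use q0 in auto)
  moreover have "s \<le> q" if "s < t" "r s = y" for s
    unfolding q_def using that by (intro Max_ge) auto
  ultimately show thesis
    using that[of q] q0 by (metis (mono_tags, lifting) leD le_less_trans mem_Collect_eq)
qed

lemma card_alternations_le:
  assumes "x \<noteq> y"
    and no_interlacing: "\<And>i j k m. i < j \<Longrightarrow> j < k \<Longrightarrow> k < m \<Longrightarrow> m < N \<Longrightarrow>
      r i = x \<Longrightarrow> r j = y \<Longrightarrow> r k = x \<Longrightarrow> r m = y \<Longrightarrow> f i = f k \<Longrightarrow> g j \<noteq> g m"
  shows "card (alternations r N x y)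
    \<le> card (f ` {t. t < N \<and> r t = x}) + card (g ` {t. t < N \<and> r t = y})"
proof -
  let ?A = "alternations r N x y" and ?X = "{t. t < N \<and> r t = x}" and ?Y = "{t. t < N \<and> r t = y}"
  let ?first = "extremal_occurrences (<) f ?X" and ?last = "extremal_occurrences (>) g ?Y"
  have "\<exists>q<t. r q = y \<and> (\<forall>s. q < s \<and> s < t \<longrightarrow> r s \<noteq> x \<and> r s \<noteq> y)" if "t \<in> ?A" for t
    using alternations_last_occurrence[OF that] by metis
  then obtain q where q: "\<And>t. t \<in> ?A \<Longrightarrow> q t < t" "\<And>t. t \<in> ?A \<Longrightarrow> r (q t) = y"
      "\<And>t s. t \<in> ?A \<Longrightarrow> q t < s \<Longrightarrow> s < t \<Longrightarrow> r s \<noteq> x \<and> r s \<noteq> y"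
    by metis
  have alt: "t < N" "r t = x" if "t \<in> ?A" for t
    using that by (simp_all add: alternations_def)
  have "inj_on q ?A"
    by (rule inj_onI) (metis alt(2) q(1,3) linorder_neqE_nat)
  moreover have "q ` (?A - ?first) \<subseteq> ?last"
  proof (rule image_subsetI)
    fix t assume t: "t \<in> ?A - ?first"
    then obtain i where i: "i < t" "r i = x" "f i = f t"
      using alt by (auto simp: extremal_occurrences_def)
    have "i < q t" using i q t \<open>x \<noteq> y\<close> by (metis DiffD1 linorder_neqE_nat)
    have "g m \<noteq> g (q t)" if m: "m < N" "r m = y" "q t < m" for m
    proof -
      have "t < m" using m q t alt \<open>x \<noteq> y\<close> by (metis DiffD1 linorder_neqE_nat)
      then have "g (q t) \<noteq> g m"
        using no_interlacing[of i "q t" t m] \<open>i < q t\<close> i(2,3) m(1,2) q[of t] alt[of t] t by blast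
      then show ?thesis by simp
    qed
    moreover have "q t < N" "r (q t) = y" using q(1,2)[of t] alt(1)[of t] t by auto
    ultimately show "q t \<in> ?last"
      by (auto simp: extremal_occurrences_def)
  qed
  ultimately have "card (?A - ?first) \<le> card (?last)"
    by (intro card_inj_on_le[of q]) (auto intro: inj_on_subset simp: extremal_occurrences_def)
  moreover have "card ?A \<le> card (?first) + card (?A - ?first)"
    using card_mono[of "?first \<union> (?A - ?first)" ?A]
      card_Un_le[of "?first" "?A - ?first"]
    by (auto simp: extremal_occurrences_def alternations_def)
  ultimately show ?thesis
    using card_extremal_occurrences_le[of ?X "(<)" f] card_extremal_occurrences_le[of ?Y "(>)" g]
    by force
qed

section \<open>Closed curves and crosscuts\<close>

lemma simple_path_eqD:
  assumes "simple_path g" "g s = g t" "0 \<le> s" "s < 1" "0 \<le> t" "t < 1"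
  shows "s = t"
  using assms unfolding simple_path_def loop_free_def by force

lemma closed_curveI:
  "simple_path g \<Longrightarrow> pathfinish g = pathstart g \<Longrightarrow> closed_curve (path_image g)"
  by (auto simp: closed_curve_def)

lemma closed_curveE:
  assumes "closed_curve A"
  obtains g where "simple_path g" "pathfinish g = pathstart g" "path_image g = A"
  using assms by (auto simp: closed_curve_def)

lemma closed_curve_startE:
  assumes "closed_curve A" "p \<in> A"
  obtains g where "simple_path g" "pathstart g = p" "pathfinish g = p" "path_image g = A"
proof -
  obtain h where h: "simple_path h" "pathfinish h = pathstart h" "path_image h = A"
    using closed_curveE[OF assms(1)] .
  then obtain a where a: "a \<in> {0..1}" "h a = p"
    using assms(2) by (auto simp: path_image_def)
  show thesis
  proof
    show "simple_path (shiftpath a h)" using h a by (simp add: simple_path_shiftpath)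
    show "path_image (shiftpath a h) = A" using h a path_image_shiftpath by blast
  qed (use endpoints_shiftpath[OF h(2) a(1)] a(2) in auto)
qed

abbreviation disc :: "complex set \<Rightarrow> complex set" where
  "disc A \<equiv> A \<union> inside A"

lemma
  assumes "closed_curve A"
  shows closed_curve_imp_compact: "compact A"
    and closed_curve_imp_closed: "closed A"
    and closed_curve_imp_connected: "connected A"
    and connected_inside_closed_curve: "connected (inside A)"
    and connected_outside_closed_curve: "connected (outside A)"
    and inside_closed_curve_nonempty: "inside A \<noteq> {}"
    and frontier_inside_closed_curve: "frontier (inside A) = A"
    and closed_disc_closed_curve: "closed (disc A)"
proof -
  obtain g where g: "simple_path g" "pathfinish g = pathstart g" "path_image g = A"
    using closed_curveE[OF assms] .
  show "compact A" "connected A"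
    using g compact_simple_path_image connected_simple_path_image by blast+
  then show "closed A" by (simp add: compact_imp_closed)
  show "connected (inside A)" "connected (outside A)" "inside A \<noteq> {}" "frontier (inside A) = A"
    using Jordan_inside_outside[OF g(1,2)] g(3) by auto
  show "closed (disc A)"
    using closed_path_image_Un_inside[OF simple_path_imp_path[OF g(1)]] g(3) by simp
qed

lemma path_connected_closed_curve_delete:
  assumes "closed_curve A"
  shows "path_connected (A - {p})"
proof (cases "p \<in> A")
  case True
  obtain g where g: "simple_path g" "pathstart g = p" "pathfinish g = p" "path_image g = A"
    using closed_curve_startE[OF assms True] .
  have "continuous_on {0<..<1} g"
    using g(1) by (intro continuous_on_path simple_path_imp_path) auto
  then have "path_connected (g ` {0<..<1})"
    by (intro path_connected_continuous_image convex_imp_path_connected) auto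
  then show ?thesis using simple_path_endless[OF g(1)] g(2-4) by simp
next
  case False
  obtain g where "simple_path g" "path_image g = A"
    using closed_curveE[OF assms] .
  then have "path_connected A"
    using path_connected_path_image[OF simple_path_imp_path] by blast
  then show ?thesis using False by simp
qed

lemma closed_curve_not_subset_singleton:
  assumes "closed_curve A"
  shows "\<not> A \<subseteq> {p}"
proof -
  obtain g where g: "simple_path g" "path_image g = A"
    using closed_curveE[OF assms] by blast
  have "g 0 \<in> A" "g (1/2) \<in> A" using g(2) by (auto simp: path_image_def)
  moreover have "g 0 \<noteq> g (1/2)" using simple_path_eqD[OF g(1), of 0 "1/2"] by auto
  ultimately show ?thesis by auto
qed

lemma interior_closed_curve:
  assumes "closed_curve A"
  shows "interior A = {}"
proof -
  have "A \<subseteq> closure (inside A)"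
    using frontier_inside_closed_curve[OF assms] by (auto simp: frontier_def)
  moreover have "interior A \<inter> inside A = {}"
    using interior_subset[of A] inside_no_overlap[of A] by blast
  then have "interior A \<inter> closure (inside A) = {}" by (simp add: open_Int_closure_eq_empty)
  ultimately show ?thesis using interior_subset[of A] by blast
qed

lemma interior_Union_closed_curves:
  assumes "finite S" "\<And>A. A \<in> S \<Longrightarrow> closed_curve A"
  shows "interior (\<Union>S) = {}"
  using assms
proof (induction S rule: finite_induct)
  case (insert A S)
  then have "interior (A \<union> \<Union>S) = {}"
    by (simp add: interior_closed_Un_empty_interior closed_curve_imp_closed interior_closed_curve)
  then show ?case by simp
qed simp

definition arc_interior :: "(real \<Rightarrow> 'a::topological_space) \<Rightarrow> 'a set" where
  "arc_interior c = path_image c - {pathstart c, pathfinish c}"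

lemma connected_arc_interior: "arc c \<Longrightarrow> connected (arc_interior c)"
  by (simp add: arc_interior_def arc_imp_simple_path connected_simple_path_endless)

lemma path_image_subset_closure_arc_interior:
  assumes "arc c"
  shows "path_image c \<subseteq> closure (arc_interior c)"
proof -
  have "c ` closure {0<..<1} \<subseteq> closure (arc_interior c)"
  proof (rule image_closure_subset)
    show "continuous_on (closure {0<..<1}) c" using assms by (simp add: arc_def path_def)
    show "c ` {0<..<1} \<subseteq> closure (arc_interior c)"
      using simple_path_endless[OF arc_imp_simple_path[OF assms]] closure_subset
      unfolding arc_interior_def by blast
  qed simp
  then show ?thesis by (simp add: path_image_def)
qed

definition complementary_arcs ::
    "(real \<Rightarrow> 'a::topological_space) \<Rightarrow> (real \<Rightarrow> 'a) \<Rightarrow> 'a \<Rightarrow> 'a \<Rightarrow> bool" where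
  "complementary_arcs c d a b \<longleftrightarrow>
     arc c \<and> pathstart c = a \<and> pathfinish c = b \<and> arc d \<and> pathstart d = a \<and> pathfinish d = b \<and>
     path_image c \<inter> path_image d = {a, b}"

lemma complementary_arcs_commute: "complementary_arcs c d a b \<longleftrightarrow> complementary_arcs d c a b"
  by (auto simp: complementary_arcs_def)

lemma complementary_arcs_ends:
  "complementary_arcs c d a b \<Longrightarrow> a \<noteq> b \<and> {a, b} \<subseteq> path_image c \<and> {a, b} \<subseteq> path_image d"
  using arc_distinct_ends[of c] by (auto simp: complementary_arcs_def)

lemma closed_curve_complementary_arcsE:
  assumes "closed_curve A" "a \<in> A" "b \<in> A" "a \<noteq> b"
  obtains c d where "complementary_arcs c d a b" "path_image c \<union> path_image d = A"
proof -
  obtain g where g: "simple_path g" "pathfinish g = pathstart g" "path_image g = A"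
    using closed_curveE[OF assms(1)] .
  obtain u d where "arc u" "arc d" "pathstart u = a" "pathfinish u = b" "pathstart d = b"
      "pathfinish d = a" "path_image u \<inter> path_image d = {a, b}" "path_image u \<union> path_image d = A"
    using exists_double_arc[OF g(1,2), of a b] assms(2-4) g(3) by metis
  then show thesis
    using that[of u "reversepath d"] by (auto simp: complementary_arcs_def arc_reversepath)
qed

lemma closed_curve_Un_complementary_arcs:
  fixes c d :: "real \<Rightarrow> complex"
  assumes "complementary_arcs c d a b"
  shows "closed_curve (path_image c \<union> path_image d)"
proof -
  have "simple_path (c +++ reversepath d)"
    using assms by (intro simple_path_join_loop) (auto simp: complementary_arcs_def arc_reversepath)
  then have "closed_curve (path_image (c +++ reversepath d))"
    using assms by (intro closed_curveI) (auto simp: complementary_arcs_def)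
  then show ?thesis
    using assms by (simp add: complementary_arcs_def path_image_join)
qed

lemma arc_continuous_image:
  assumes "arc c" "continuous_on (path_image c) f" "inj_on f (path_image c)"
  shows "arc (f \<circ> c)"
  using assms path_continuous_image comp_inj_on unfolding arc_def path_image_def by blast

lemma complementary_arcs_image:
  assumes cd: "complementary_arcs c d a b"
    and f: "continuous_on (path_image c \<union> path_image d) f" "inj_on f (path_image c \<union> path_image d)"
  shows "complementary_arcs (f \<circ> c) (f \<circ> d) (f a) (f b)"
proof -
  have "arc (f \<circ> c)" "arc (f \<circ> d)"
    using cd f by (auto simp: complementary_arcs_def intro!: arc_continuous_image
        elim: continuous_on_subset inj_on_subset)
  moreover have "f ` path_image c \<inter> f ` path_image d = f ` {a, b}"
    using cd inj_on_image_Int[OF f(2), of "path_image c" "path_image d"]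
    by (simp add: complementary_arcs_def)
  ultimately show ?thesis
    using cd
    by (auto simp: complementary_arcs_def pathstart_compose pathfinish_compose path_image_compose)
qed

lemma subarc_between_closed_sets:
  fixes p :: "real \<Rightarrow> 'a::{complete_space,real_normed_vector}"
  assumes p: "path p" "pathstart p \<in> A" "pathfinish p \<in> B"
    and AB: "closed A" "closed B" "path_image p \<inter> (A \<inter> B) = {}"
  obtains c where "arc c" "path_image c \<subseteq> path_image p" "pathstart c \<in> A" "pathfinish c \<in> B"
    "arc_interior c \<inter> (A \<union> B) = {}"
proof -
  have "pathstart p \<in> closure (- B)"
    using p(2) AB(3) closure_subset[of "- B"] pathstart_in_path_image[of p] by blast
  then obtain q where q: "path q" "pathstart q = pathstart p" "path_image q \<subseteq> path_image p"
      "path_image q - {pathfinish q} \<subseteq> interior (- B)" "pathfinish q \<in> frontier (- B)"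
    using exists_path_subpath_to_frontier[OF p(1), of "- B"] p(3) by auto
  have "pathfinish q \<in> B"
    using q(5) frontier_subset_closed[OF AB(2)] by (auto simp: frontier_complement)
  then have "pathfinish q \<in> closure (- A)"
    using q(3) AB(3) closure_subset[of "- A"] pathfinish_in_path_image[of q] by blast
  then obtain r where r: "path r" "pathstart r = pathfinish q" "path_image r \<subseteq> path_image q"
      "path_image r - {pathfinish r} \<subseteq> interior (- A)" "pathfinish r \<in> frontier (- A)"
    using exists_path_subpath_to_frontier[of "reversepath q" "- A"] q(1,2) p(2) by auto
  have "pathfinish r \<in> A"
    using r(5) frontier_subset_closed[OF AB(1)] by (auto simp: frontier_complement)
  then have "pathfinish r \<noteq> pathstart r"
    using \<open>pathfinish q \<in> B\<close> AB(3) q(3) r(2) pathfinish_in_path_image[of q] by auto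
  then obtain c where c: "arc c" "path_image c \<subseteq> path_image r" "pathstart c = pathfinish r"
      "pathfinish c = pathstart r"
    using path_contains_arc[of "reversepath r" "pathfinish r" "pathstart r"] r(1) by auto
  have "path_image r - {pathfinish r} \<subseteq> - A" "path_image q - {pathfinish q} \<subseteq> - B"
    by (rule order_trans[OF r(4) interior_subset], rule order_trans[OF q(4) interior_subset])
  then have "arc_interior c \<subseteq> - A" "arc_interior c \<subseteq> - B"
    using c(2-4) r(2,3) by (auto simp: arc_interior_def)
  then have "arc_interior c \<inter> (A \<union> B) = {}" by blast
  moreover have "path_image c \<subseteq> path_image p" using c(2) r(3) q(3) by blast
  ultimately show thesis
    using that[of c] c(1,3,4) r(2) \<open>pathfinish r \<in> A\<close> \<open>pathfinish q \<in> B\<close> by simp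
qed

lemma connected_inside_or_outside:
  "connected Q \<Longrightarrow> Q \<inter> A = {} \<Longrightarrow> Q \<subseteq> inside A \<or> Q \<subseteq> outside A"
  using inside_outside_intersect_connected[of Q A] inside_Un_outside[of A] by blast

context
  fixes c1 c2 c :: "real \<Rightarrow> complex" and a b :: complex and G G1 G2 :: "complex set"
  assumes arcs: "complementary_arcs c1 c2 a b"
    and c: "arc c" "pathstart c = a" "pathfinish c = b"
  defines "G \<equiv> path_image c1 \<union> path_image c2"
    and "G1 \<equiv> path_image c1 \<union> path_image c" and "G2 \<equiv> path_image c2 \<union> path_image c"
  assumes crosscut: "path_image c - {a, b} \<subseteq> inside G"
begin

lemma crosscut_complementary_arcs: "complementary_arcs c1 c a b" "complementary_arcs c2 c a b"
proof -
  have "G \<inter> (path_image c - {a, b}) = {}"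
    using crosscut inside_no_overlap[of G] by blast
  then have "path_image c1 \<inter> path_image c = {a, b}" "path_image c2 \<inter> path_image c = {a, b}"
    using complementary_arcs_ends[OF arcs] c(2,3) pathstart_in_path_image[of c]
      pathfinish_in_path_image[of c] by (auto simp: G_def)
  then show "complementary_arcs c1 c a b" "complementary_arcs c2 c a b"
    using arcs c by (auto simp: complementary_arcs_def)
qed

lemma
  shows crosscut_inside_disjoint: "inside G1 \<inter> inside G2 = {}"
    and crosscut_inside_Un: "inside G1 \<union> inside G2 \<union> (path_image c - {a, b}) = inside G"
proof -
  have "path_image c - {a, b} \<noteq> {}"
    using nonempty_simple_path_endless[OF arc_imp_simple_path[OF c(1)]] c(2,3) by simp
  then have "path_image c \<inter> inside G \<noteq> {}"
    using crosscut by blast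
  then show "inside G1 \<inter> inside G2 = {}"
    "inside G1 \<union> inside G2 \<union> (path_image c - {a, b}) = inside G"
    using split_inside_simple_closed_curve[of c1 a b c2 c] arcs crosscut_complementary_arcs
      complementary_arcs_ends[OF arcs] unfolding G_def G1_def G2_def
    by (simp_all add: complementary_arcs_def arc_imp_simple_path) metis+
qed

lemma crosscut_discs_Int: "disc G1 \<inter> disc G2 = path_image c"
proof -
  have "inside G1 \<inter> G1 = {}" "inside G2 \<inter> G2 = {}" "inside G \<inter> G = {}"
    by (fact inside_no_overlap)+
  then have "inside G1 \<inter> G2 = {}" "inside G2 \<inter> G1 = {}"
    using crosscut_inside_Un unfolding G_def G1_def G2_def by blast+
  then show ?thesis
    using crosscut_inside_disjoint arcs crosscut_complementary_arcs
    by (auto simp: complementary_arcs_def G1_def G2_def)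
qed

lemma crosscut_connected_in_disc:
  assumes "connected Q" "Q \<subseteq> disc G" "Q \<inter> path_image c = {}"
  shows "Q \<subseteq> disc G1 \<or> Q \<subseteq> disc G2"
proof -
  have "closed (disc G1)" "closed (disc G2)"
    using crosscut_complementary_arcs unfolding G1_def G2_def
    by (simp_all add: closed_disc_closed_curve closed_curve_Un_complementary_arcs)
  moreover have "Q \<subseteq> disc G1 \<union> disc G2"
    using assms(2) crosscut_inside_Un unfolding G_def G1_def G2_def by blast
  ultimately show ?thesis
    using connected_closedD[OF assms(1), of "disc G1" "disc G2"] crosscut_discs_Int assms(3)
    by blast
qed

end

section \<open>Interlacing points and intersecting chords\<close>

definition interlaced :: "complex set \<Rightarrow> complex \<Rightarrow> complex \<Rightarrow> complex \<Rightarrow> complex \<Rightarrow> bool" where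
  "interlaced A a b c d \<longleftrightarrow>
     {a, b, c, d} \<subseteq> A \<and> distinct [a, b, c, d] \<and> \<not> connected_component (A - {a, b}) c d"

lemma
  assumes "interlaced A a b c d"
  shows interlaced_swap_left: "interlaced A b a c d"
    and interlaced_swap_right: "interlaced A a b d c"
  using assms by (auto simp: interlaced_def insert_commute connected_component_sym_eq)

lemma interlacedI:
  assumes arcs: "complementary_arcs c1 c2 a b"
    and "c \<in> path_image c1 - {a, b}" "d \<in> path_image c2 - {a, b}"
  shows "interlaced (path_image c1 \<union> path_image c2) a b c d"
proof -
  have "\<not> connected_component (path_image c1 \<union> path_image c2 - {a, b}) c d"
  proof
    assume "connected_component (path_image c1 \<union> path_image c2 - {a, b}) c d"
    then obtain Q where Q: "connected Q" "Q \<subseteq> path_image c1 \<union> path_image c2 - {a, b}"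
        "c \<in> Q" "d \<in> Q"
      by (auto simp: connected_component_def)
    moreover have "closed (path_image c1)" "closed (path_image c2)"
      using arcs by (auto simp: complementary_arcs_def closed_arc_image)
    ultimately show False
      using connected_closedD[OF Q(1), of "path_image c1" "path_image c2"] assms
      by (auto simp: complementary_arcs_def)
  qed
  moreover have "c \<noteq> d" using assms by (auto simp: complementary_arcs_def)
  ultimately show ?thesis
    using assms complementary_arcs_ends[OF arcs] by (auto simp: interlaced_def)
qed

lemma interlacedE:
  assumes "closed_curve A" and int: "interlaced A a b c d"
  obtains c1 c2 where "complementary_arcs c1 c2 a b" "path_image c1 \<union> path_image c2 = A"
    "c \<in> path_image c1 - {a, b}" "d \<in> path_image c2 - {a, b}"
proof -
  have cd: "c \<in> A - {a, b}" "d \<in> A - {a, b}" and "a \<in> A" "b \<in> A" "a \<noteq> b"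
    using int by (auto simp: interlaced_def)
  obtain c1 c2 where arcs: "complementary_arcs c1 c2 a b" "path_image c1 \<union> path_image c2 = A"
    using closed_curve_complementary_arcsE[OF assms(1) \<open>a \<in> A\<close> \<open>b \<in> A\<close> \<open>a \<noteq> b\<close>] .
  have "\<not> (c \<in> path_image e \<and> d \<in> path_image e)" if "e = c1 \<or> e = c2" for e
  proof
    assume in_e: "c \<in> path_image e \<and> d \<in> path_image e"
    have "connected (path_image e - {a, b})"
      using that arcs(1) connected_simple_path_endless[OF arc_imp_simple_path, of e]
      by (auto simp: complementary_arcs_def)
    then have "connected_component (A - {a, b}) c d"
      unfolding connected_component_def using in_e cd that arcs(2)
      by (intro exI[of _ "path_image e - {a, b}"]) auto
    then show False using int by (simp add: interlaced_def)
  qed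
  then consider "c \<in> path_image c1" "d \<in> path_image c2" | "c \<in> path_image c2" "d \<in> path_image c1"
    using cd arcs(2) by blast
  then show thesis
  proof cases
    case 1
    then show ?thesis using that[of c1 c2] arcs cd by simp
  next
    case 2
    then show ?thesis using that[of c2 c1] arcs cd complementary_arcs_commute by blast
  qed
qed

lemma interlaced_sym:
  assumes A: "closed_curve A" and int: "interlaced A a b c d"
  shows "interlaced A c d a b"
proof -
  have "c \<in> A" "d \<in> A" "c \<noteq> d" and distinct: "distinct [a, b, c, d]"
    using int by (auto simp: interlaced_def)
  obtain d1 d2 where d12: "complementary_arcs d1 d2 c d" "path_image d1 \<union> path_image d2 = A"
    using closed_curve_complementary_arcsE[OF A \<open>c \<in> A\<close> \<open>d \<in> A\<close> \<open>c \<noteq> d\<close>] .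
  have meets: "a \<in> path_image e \<or> b \<in> path_image e" if "e = d1 \<or> e = d2" for e
  proof (rule ccontr)
    assume "\<not> ?thesis"
    then have "path_image e \<subseteq> A - {a, b}" using d12(2) that by auto
    moreover have "connected (path_image e)" "c \<in> path_image e" "d \<in> path_image e"
      using that d12(1) complementary_arcs_ends[OF d12(1)]
      by (auto simp: complementary_arcs_def connected_arc_image)
    ultimately show False
      using int unfolding interlaced_def connected_component_def by blast
  qed
  have "path_image d1 \<inter> path_image d2 = {c, d}" using d12(1) by (simp add: complementary_arcs_def)
  then consider "a \<in> path_image d1 - {c, d}" "b \<in> path_image d2 - {c, d}"
    | "b \<in> path_image d1 - {c, d}" "a \<in> path_image d2 - {c, d}"
    using meets[of d1] meets[of d2] distinct by auto
  then show ?thesis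
    using interlacedI[OF d12(1)] interlaced_swap_right d12(2) by cases blast+
qed

lemma interlaced_exclusive:
  assumes A: "closed_curve A" and int: "interlaced A a b c d"
  shows "\<not> interlaced A a d c b"
proof -
  obtain c1 c2 where arcs: "complementary_arcs c1 c2 a b" "path_image c1 \<union> path_image c2 = A"
      "c \<in> path_image c1 - {a, b}" "d \<in> path_image c2 - {a, b}"
    using interlacedE[OF A int] .
  have c1: "arc c1" "c1 0 = a" "c1 1 = b"
    using arcs(1) by (auto simp: complementary_arcs_def pathstart_def pathfinish_def)
  obtain s where "s \<in> {0..1}" "c1 s = c"
    using arcs(3) by (auto simp: path_image_def)
  then have s: "0 < s" "s \<le> 1" "c1 s = c"
    using arcs(3) c1(2) by (auto simp: order_le_less)
  have "connected (c1 ` {s..1})"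
    using s c1(1) by (intro connected_continuous_image continuous_on_path arc_imp_path) auto
  moreover have "c1 ` {s..1} \<subseteq> path_image c1"
    using s by (auto simp: path_image_def)
  moreover have "a \<notin> c1 ` {s..1}"
  proof
    assume "a \<in> c1 ` {s..1}"
    then obtain t where "s \<le> t" "t \<le> 1" "c1 t = c1 0" using c1(2) by auto
    then show False using arcD[OF c1(1), of t 0] s by auto
  qed
  moreover have "d \<notin> path_image c1"
    using arcs(1,4) by (auto simp: complementary_arcs_def)
  ultimately have "connected_component (A - {a, d}) c b"
    unfolding connected_component_def using s c1(3) arcs(2)
    by (intro exI[of _ "c1 ` {s..1}"]) auto
  then show ?thesis by (simp add: interlaced_def)
qed

lemma interlaced_parametrized:
  assumes g: "simple_path g" "pathfinish g = pathstart g"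
    and ord: "0 \<le> s1" "s1 < s2" "s2 < s3" "s3 < s4" "s4 < 1"
  shows "interlaced (path_image g) (g s1) (g s3) (g s2) (g s4)"
proof -
  define B where "B = g ` {0..s1} \<union> g ` {s3..1}"
  have g1: "g 1 = g 0" using g(2) by (simp add: pathstart_def pathfinish_def)
  have image: "path_image g = g ` {s1..s3} \<union> B"
    unfolding B_def path_image_def image_Un[symmetric] using ord
    by (intro arg_cong[of _ _ "image g"]) auto
  have "closed (g ` {u..v})" if "0 \<le> u" "v \<le> 1" for u v
    using that g(1) by (intro compact_imp_closed compact_continuous_image continuous_on_path
        simple_path_imp_path) auto
  then have closed: "closed (g ` {s1..s3})" "closed B"
    using ord by (auto simp: B_def)
  have "x \<in> {g s1, g s3}" if x: "x \<in> g ` {s1..s3}" "x \<in> B" for x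
  proof -
    obtain s where "x = g s" "s1 \<le> s" "s \<le> s3" using x(1) by auto
    moreover obtain t where "x = g t" "t \<in> {0..s1} \<union> {s3..1}" using x(2) by (auto simp: B_def)
    ultimately have st: "x = g s" "x = g t" "s1 \<le> s" "s \<le> s3" "0 \<le> t" "t \<le> s1 \<or> s3 \<le> t" "t \<le> 1"
      using ord by auto
    show ?thesis
    proof (cases "t = 1")
      case True
      then have "s = 0" using simple_path_eqD[OF g(1), of s 0] st ord g1 by auto
      then show ?thesis using st ord by auto
    next
      case False
      then have "s = t" using simple_path_eqD[OF g(1), of s t] st ord by auto
      then show ?thesis using st by auto
    qed
  qed
  moreover have "g s2 \<in> g ` {s1..s3}" "g s4 \<in> B" using ord by (auto simp: B_def)
  ultimately have "\<not> connected_component (path_image g - {g s1, g s3}) (g s2) (g s4)"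
    unfolding connected_component_def image
    using connected_closedD[OF _ _ _ closed] by blast
  moreover have "distinct [g s1, g s3, g s2, g s4]"
    using simple_path_eqD[OF g(1)] ord by (auto, force+)
  ultimately show ?thesis
    using ord by (auto simp: interlaced_def path_image_def)
qed

lemma interlaced_cases:
  assumes A: "closed_curve A" and "{a, b, c, d} \<subseteq> A" "distinct [a, b, c, d]"
  obtains "interlaced A a b c d" | "interlaced A a c b d" | "interlaced A a d b c"
proof -
  obtain g where g: "simple_path g" "pathstart g = a" "pathfinish g = a" "path_image g = A"
    using closed_curve_startE[OF A] assms(2) by blast
  have "\<exists>t. 0 < t \<and> t < 1 \<and> g t = p" if p: "p \<in> A" "p \<noteq> a" for p
  proof -
    obtain t where "0 \<le> t" "t \<le> 1" "g t = p" using p(1) g(4) by (auto simp: path_image_def)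
    then show ?thesis
      using p(2) g(2,3)
      by (intro exI[of _ t]) (auto simp: pathstart_def pathfinish_def order_le_less)
  qed
  then obtain \<tau> where \<tau>: "\<And>p. p \<in> A \<Longrightarrow> p \<noteq> a \<Longrightarrow> 0 < \<tau> p \<and> \<tau> p < 1 \<and> g (\<tau> p) = p"
    by metis
  have ordered: "interlaced A a q p r"
    if "{p, q, r} \<subseteq> A - {a}" "\<tau> p < \<tau> q" "\<tau> q < \<tau> r" for p q r
    using interlaced_parametrized[OF g(1), of 0 "\<tau> p" "\<tau> q" "\<tau> r"] that g(2-4)
      \<tau>[of p] \<tau>[of q] \<tau>[of r] by (simp add: pathstart_def)
  have between: "interlaced A a q p r"
    if "{p, q, r} \<subseteq> A - {a}" "\<tau> p < \<tau> q \<and> \<tau> q < \<tau> r \<or> \<tau> r < \<tau> q \<and> \<tau> q < \<tau> p" for p q r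
    using ordered[of p q r] ordered[of r q p] interlaced_swap_right that by auto
  have points: "{b, c, d} \<subseteq> A - {a}" using assms(2,3) by auto
  have "\<tau> b \<noteq> \<tau> c" "\<tau> b \<noteq> \<tau> d" "\<tau> c \<noteq> \<tau> d"
    using \<tau>[of b] \<tau>[of c] \<tau>[of d] assms(2,3) by auto
  then consider (b) "\<tau> c < \<tau> b \<and> \<tau> b < \<tau> d \<or> \<tau> d < \<tau> b \<and> \<tau> b < \<tau> c"
    | (c) "\<tau> b < \<tau> c \<and> \<tau> c < \<tau> d \<or> \<tau> d < \<tau> c \<and> \<tau> c < \<tau> b"
    | (d) "\<tau> b < \<tau> d \<and> \<tau> d < \<tau> c \<or> \<tau> c < \<tau> d \<and> \<tau> d < \<tau> b"
    by linarith
  then show thesis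
  proof cases
    case b
    then show ?thesis using between[of c b d] points that(1) by simp
  next
    case c
    then show ?thesis using between[of b c d] points that(2) by simp
  next
    case d
    then show ?thesis using between[of b d c] points that(3) by simp
  qed
qed

lemma interlaced_chords_intersect_inside:
  assumes G: "closed_curve G" and int: "interlaced G a b c d"
    and P: "path_component P a b" "P \<subseteq> disc G"
    and Q: "connected_component Q c d" "Q \<subseteq> disc G"
  shows "P \<inter> Q \<noteq> {}"
proof
  assume disj: "P \<inter> Q = {}"
  obtain p where p: "path p" "path_image p \<subseteq> P" "pathstart p = a" "pathfinish p = b"
    using P(1) by (auto simp: path_component_def)
  obtain R where R: "connected R" "R \<subseteq> Q" "c \<in> R" "d \<in> R"
    using Q(1) by (auto simp: connected_component_def)
  obtain c1 c2 where arcs: "complementary_arcs c1 c2 c d" "path_image c1 \<union> path_image c2 = G"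
      "a \<in> path_image c1 - {c, d}" "b \<in> path_image c2 - {c, d}"
    using interlacedE[OF G interlaced_sym[OF G int]] .
  have "closed (path_image c1)" "closed (path_image c2)"
    "path_image p \<inter> (path_image c1 \<inter> path_image c2) = {}"
    using arcs(1) R disj p(2) by (auto simp: complementary_arcs_def closed_arc_image)
  then obtain e where e: "arc e" "path_image e \<subseteq> path_image p" "pathstart e \<in> path_image c1"
      "pathfinish e \<in> path_image c2" "arc_interior e \<inter> G = {}"
    using subarc_between_closed_sets[of p "path_image c1" "path_image c2"] p(1,3,4) arcs
    by (metis DiffD1)
  define u v where "u = pathstart e" and "v = pathfinish e"
  have uv_in: "u \<in> path_image e" "v \<in> path_image e" by (auto simp: u_def v_def)
  have eR: "R \<inter> path_image e = {}" using R(2) disj p(2) e(2) by blast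
  then have uv: "u \<in> path_image c1 - {c, d}" "v \<in> path_image c2 - {c, d}"
    using uv_in R(3,4) e(3,4) by (auto simp: u_def v_def)
  have "interlaced G u v c d"
    using interlaced_sym[OF G] interlacedI[OF arcs(1) uv] arcs(2) by simp
  then obtain d1 d2 where d12: "complementary_arcs d1 d2 u v" "path_image d1 \<union> path_image d2 = G"
      "c \<in> path_image d1 - {u, v}" "d \<in> path_image d2 - {u, v}"
    using interlacedE[OF G] by blast
  have crosscut: "path_image e - {u, v} \<subseteq> inside (path_image d1 \<union> path_image d2)"
    using e(2,5) p(2) P(2) d12(2) by (auto simp: u_def v_def arc_interior_def)
  note cut = d12(1) e(1) u_def[symmetric] v_def[symmetric] crosscut
  have "R \<subseteq> disc (path_image d1 \<union> path_image e)
      \<or> R \<subseteq> disc (path_image d2 \<union> path_image e)"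
    using crosscut_connected_in_disc[OF cut R(1)] R(2) Q(2) eR d12(2) by auto
  then show False
    using crosscut_discs_Int[OF cut] R(3,4) eR d12(3,4) by blast
qed

definition closed_sides :: "complex set \<Rightarrow> complex set set" where
  "closed_sides A = {disc A, A \<union> outside A}"

definition inversion :: "complex \<Rightarrow> complex \<Rightarrow> complex" where
  "inversion a z = inverse (z - a)"

lemma continuous_on_inversion: "a \<notin> S \<Longrightarrow> continuous_on S (inversion a)"
  unfolding inversion_def by (intro continuous_intros) auto

lemma inj_inversion: "inj (inversion a)"
  by (rule injI) (simp add: inversion_def)

lemma closed_curve_inversion:
  assumes "closed_curve A" "a \<notin> A"
  shows "closed_curve (inversion a ` A)"
proof -
  obtain g where g: "simple_path g" "pathfinish g = pathstart g" "path_image g = A"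
    using closed_curveE[OF assms(1)] .
  have "simple_path (inversion a \<circ> g)"
    using g assms(2) by (intro simple_path_continuous_image continuous_on_inversion)
      (auto intro: inj_on_subset[OF inj_inversion])
  then show ?thesis
    using closed_curveI[of "inversion a \<circ> g"] g
    by (simp add: path_image_compose pathstart_compose pathfinish_compose)
qed

lemma interlaced_inversion:
  assumes A: "closed_curve A" "a \<notin> A" and int: "interlaced A p q r s"
  shows "interlaced (inversion a ` A)
    (inversion a p) (inversion a q) (inversion a r) (inversion a s)"
proof -
  obtain c1 c2 where arcs: "complementary_arcs c1 c2 p q" "path_image c1 \<union> path_image c2 = A"
      "r \<in> path_image c1 - {p, q}" "s \<in> path_image c2 - {p, q}"
    using interlacedE[OF A(1) int] .
  have "complementary_arcs (inversion a \<circ> c1) (inversion a \<circ> c2) (inversion a p) (inversion a q)"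
    using arcs(1,2) A(2) by (intro complementary_arcs_image continuous_on_inversion)
      (auto intro: inj_on_subset[OF inj_inversion])
  from interlacedI[OF this] show ?thesis
    using arcs(3,4) unfolding arcs(2)[symmetric] image_Un
    by (simp add: path_image_compose inj_eq[OF inj_inversion])
qed

lemma inversion_image_inside_or_outside:
  assumes "connected X" "a \<notin> X" "X \<inter> A = {}"
  shows "inversion a ` X \<subseteq> inside (inversion a ` A) \<or> inversion a ` X \<subseteq> outside (inversion a ` A)"
proof (rule connected_inside_or_outside)
  show "connected (inversion a ` X)"
    using assms(1,2) by (intro connected_continuous_image continuous_on_inversion)
  show "inversion a ` X \<inter> inversion a ` A = {}"
    using assms(3) by (simp add: image_Int[OF inj_inversion, symmetric])
qed

lemma inversion_punctured_inside_subset_outside: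
  assumes A: "closed_curve A" and a: "a \<in> inside A"
  shows "inversion a ` (inside A - {a}) \<subseteq> outside (inversion a ` A)"
proof -
  have open_inside_A: "open (inside A)"
    by (rule open_inside[OF closed_curve_imp_closed[OF A]])
  have "a \<notin> A" using a inside_no_overlap[of A] by blast
  then have "bounded (inside (inversion a ` A))"
    using A
    by (intro bounded_inside compact_imp_bounded closed_curve_imp_compact closed_curve_inversion)
  then obtain R where R: "R > 0" "\<And>w. w \<in> inside (inversion a ` A) \<Longrightarrow> norm w \<le> R"
    by (auto simp: bounded_pos)
  obtain e where e: "e > 0" "ball a e \<subseteq> inside A"
    using open_inside_A a open_contains_ball by blast
  define r where "r = min (e / 2) (1 / (2 * R))"
  have r: "0 < r" "r < e" "R < inverse r"
    using R(1) e(1) by (auto simp: r_def min_def field_simps)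
  have "norm (inversion a (a + of_real r)) = inverse r"
    using r(1) by (simp add: inversion_def norm_inverse)
  then have "inversion a (a + of_real r) \<notin> inside (inversion a ` A)"
    using R(2)[of "inversion a (a + of_real r)"] r(3) by linarith
  moreover have "a + of_real r \<in> inside A - {a}" using e(2) r by (auto simp: dist_norm)
  ultimately have "\<not> inversion a ` (inside A - {a}) \<subseteq> inside (inversion a ` A)" by blast
  moreover have "connected (inside A - {a})"
    using open_inside_A connected_inside_closed_curve[OF A] by (intro connected_open_delete) auto
  moreover have "(inside A - {a}) \<inter> A = {}"
    using inside_no_overlap[of A] by blast
  ultimately show ?thesis
    using inversion_image_inside_or_outside[of "inside A - {a}" a A] by blast
qed

lemma inversion_outside_subset_inside:
  assumes A: "closed_curve A" and a: "a \<in> inside A"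
  shows "inversion a ` outside A \<subseteq> inside (inversion a ` A)"
proof -
  let ?A' = "inversion a ` A"
  have notin: "a \<notin> A" "a \<notin> outside A"
    using a inside_no_overlap[of A] inside_Int_outside[of A] by blast+
  note A' = closed_curve_inversion[OF A notin(1)]
  have "open (inside ?A')" by (rule open_inside[OF closed_curve_imp_closed[OF A']])
  then have "inside ?A' \<noteq> {0}" using not_open_singleton[of "0::complex"] by metis
  then obtain w where w: "w \<in> inside ?A'" "w \<noteq> 0"
    using inside_closed_curve_nonempty[OF A'] by blast
  define z where "z = a + inverse w"
  have z: "inversion a z = w" "z \<noteq> a" using w(2) by (auto simp: z_def inversion_def)
  have "z \<notin> A" using w(1) z(1) inside_no_overlap[of ?A'] by blast
  moreover have "z \<notin> inside A"
    using inversion_punctured_inside_subset_outside[OF A a] inside_Int_outside[of ?A'] w(1) z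
    by blast
  ultimately have "z \<in> outside A" using inside_Un_outside[of A] by blast
  then have "\<not> inversion a ` outside A \<subseteq> outside ?A'"
    using w(1) z(1) inside_Int_outside[of ?A'] by blast
  then show ?thesis
    using inversion_image_inside_or_outside[OF connected_outside_closed_curve[OF A] notin(2), of A]
      outside_no_overlap[of A] by blast
qed

theorem interlaced_chords_intersect:
  assumes G: "closed_curve G" and K: "K \<in> closed_sides G" and int: "interlaced G a b c d"
    and P: "path_component P a b" "P \<subseteq> K" and Q: "connected_component Q c d" "Q \<subseteq> K"
  shows "P \<inter> Q \<noteq> {}"
proof (cases "K = disc G")
  case True
  then show ?thesis using interlaced_chords_intersect_inside G int P Q by blast
next
  case False
  then have K: "K = G \<union> outside G" using K by (auto simp: closed_sides_def)
  obtain z where z: "z \<in> inside G" using inside_closed_curve_nonempty[OF G] by blast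
  then have "z \<notin> G" "z \<notin> K"
    unfolding K using inside_no_overlap[of G] inside_Int_outside[of G] by blast+
  let ?f = "inversion z"
  have cont: "continuous_on K ?f" using \<open>z \<notin> K\<close> by (rule continuous_on_inversion)
  have fK: "?f ` K \<subseteq> disc (?f ` G)"
    unfolding K image_Un using inversion_outside_subset_inside[OF G z] by blast
  have "?f ` P \<inter> ?f ` Q \<noteq> {}"
  proof (rule interlaced_chords_intersect_inside)
    show "closed_curve (?f ` G)" using G \<open>z \<notin> G\<close> by (rule closed_curve_inversion)
    show "interlaced (?f ` G) (?f a) (?f b) (?f c) (?f d)"
      using G \<open>z \<notin> G\<close> int by (rule interlaced_inversion)
    obtain p where "path p" "path_image p \<subseteq> P" "pathstart p = a" "pathfinish p = b"
      using P(1) by (auto simp: path_component_def)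
    then show "path_component (?f ` P) (?f a) (?f b)"
      unfolding path_component_def using P(2)
      by (intro exI[of _ "?f \<circ> p"])
        (auto simp: path_image_compose pathstart_compose pathfinish_compose
          intro!: path_continuous_image continuous_on_subset[OF cont])
    obtain R where "connected R" "R \<subseteq> Q" "c \<in> R" "d \<in> R"
      using Q(1) by (auto simp: connected_component_def)
    then show "connected_component (?f ` Q) (?f c) (?f d)"
      unfolding connected_component_def using Q(2)
      by (intro exI[of _ "?f ` R"])
        (auto intro!: connected_continuous_image continuous_on_subset[OF cont])
  qed (use P(2) Q(2) fK in blast)+
  then show ?thesis by (simp add: image_Int[OF inj_inversion, symmetric])
qed

section \<open>Pushing a Jordan curve off other curves\<close>

definition inseparable_by :: "complex set \<Rightarrow> complex set set \<Rightarrow> bool" where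
  "inseparable_by X S \<longleftrightarrow> (\<forall>B\<in>S. closed_curve B \<and> (\<exists>p. B \<inter> X \<subseteq> {p})) \<and>
     (\<forall>B\<in>S. \<forall>C\<in>S. B \<noteq> C \<longrightarrow> \<not> B \<inter> C \<subseteq> X)"

lemma inseparable_by_subset: "inseparable_by X S \<Longrightarrow> Y \<subseteq> X \<Longrightarrow> inseparable_by Y S"
  unfolding inseparable_by_def by (meson Int_mono order_refl subset_trans)

lemma inseparable_by_same_side:
  assumes S: "inseparable_by X S" and "U \<inter> V \<subseteq> X"
    and sides: "\<And>B. B \<in> S \<Longrightarrow> connected (B - X) \<Longrightarrow> B - X \<subseteq> U \<or> B - X \<subseteq> V"
  shows "(\<forall>B\<in>S. B \<subseteq> X \<union> U) \<or> (\<forall>B\<in>S. B \<subseteq> X \<union> V)"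
proof -
  have side: "B - X \<subseteq> U \<or> B - X \<subseteq> V" if "B \<in> S" for B
  proof -
    obtain p where B: "closed_curve B" "B \<inter> X \<subseteq> {p}"
      using S \<open>B \<in> S\<close> by (auto simp: inseparable_by_def)
    then consider "B - X = B - {p}" | "B - X = B" by blast
    then have "connected (B - X)"
      by cases (simp_all add: B(1) closed_curve_imp_connected path_connected_imp_connected
          path_connected_closed_curve_delete)
    then show ?thesis using sides that by blast
  qed
  show ?thesis
  proof (rule ccontr)
    assume "\<not> ?thesis"
    then obtain B C where BC: "B \<in> S" "\<not> B - X \<subseteq> U" "C \<in> S" "\<not> C - X \<subseteq> V" by blast
    then have "B - X \<subseteq> V" "C - X \<subseteq> U" using side by blast+
    then have "B \<inter> C \<subseteq> X" "B \<noteq> C" using \<open>U \<inter> V \<subseteq> X\<close> BC by blast+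
    then show False using S BC(1,3) by (auto simp: inseparable_by_def)
  qed
qed

lemma inseparable_by_closed_curve:
  assumes "inseparable_by A S"
  shows "\<exists>K\<in>closed_sides A. \<forall>B\<in>S. B \<subseteq> K"
proof -
  have "(\<forall>B\<in>S. B \<subseteq> disc A) \<or> (\<forall>B\<in>S. B \<subseteq> A \<union> outside A)"
  proof (rule inseparable_by_same_side[OF assms])
    show "inside A \<inter> outside A \<subseteq> A" by simp
    show "B - A \<subseteq> inside A \<or> B - A \<subseteq> outside A" if "connected (B - A)" for B
      using connected_inside_or_outside[OF that, of A] by blast
  qed
  then show ?thesis by (simp add: closed_sides_def)
qed

definition pushed_off :: "complex set \<Rightarrow> complex set \<Rightarrow> complex set set \<Rightarrow> complex set \<Rightarrow> bool" where
  "pushed_off G X S G' \<longleftrightarrow> closed_curve G' \<and> G' \<subseteq> G \<union> X \<and> inside G' \<subseteq> inside G \<and>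
     X \<inter> inside G' = {} \<and> (\<forall>B\<in>S. B \<subseteq> disc G')"

lemma pushed_offD:
  assumes "pushed_off G X S G'"
  shows "closed_curve G'" "G' \<subseteq> G \<union> X" "inside G' \<subseteq> inside G" "X \<inter> inside G' = {}"
    "\<And>B. B \<in> S \<Longrightarrow> B \<subseteq> disc G'"
  using assms by (simp_all add: pushed_off_def)

lemma pushed_off_trans:
  assumes "pushed_off G X S G'" "pushed_off G' Y S G''"
  shows "pushed_off G (X \<union> Y) S G''"
  using pushed_offD(2-4)[OF assms(1)] pushed_offD[OF assms(2)] unfolding pushed_off_def by auto

lemma push_off_crosscut:
  assumes G: "closed_curve G" and c: "arc c" "pathstart c \<in> G" "pathfinish c \<in> G"
    and crosscut: "arc_interior c \<subseteq> inside G"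
    and S: "inseparable_by (path_image c) S" "\<And>B. B \<in> S \<Longrightarrow> B \<subseteq> disc G"
  shows "\<exists>G'. pushed_off G (path_image c) S G'"
proof -
  obtain c1 c2 where arcs: "complementary_arcs c1 c2 (pathstart c) (pathfinish c)"
      "path_image c1 \<union> path_image c2 = G"
    using closed_curve_complementary_arcsE[OF G c(2,3)] arc_distinct_ends[OF c(1)] by metis
  note cut = arcs(1) c(1) refl refl crosscut[unfolded arc_interior_def arcs(2)[symmetric]]
  define G1 G2 where "G1 = path_image c1 \<union> path_image c" and "G2 = path_image c2 \<union> path_image c"
  have "(\<forall>B\<in>S. B \<subseteq> path_image c \<union> disc G1) \<or> (\<forall>B\<in>S. B \<subseteq> path_image c \<union> disc G2)"
  proof (rule inseparable_by_same_side[OF S(1)])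
    show "disc G1 \<inter> disc G2 \<subseteq> path_image c"
      unfolding G1_def G2_def using crosscut_discs_Int[OF cut] by simp
    show "B - path_image c \<subseteq> disc G1 \<or> B - path_image c \<subseteq> disc G2"
      if "B \<in> S" "connected (B - path_image c)" for B
      using crosscut_connected_in_disc[OF cut that(2)] S(2)[OF that(1)]
      unfolding arcs(2) G1_def G2_def by blast
  qed
  then obtain H where H: "H = G1 \<or> H = G2" "\<forall>B\<in>S. B \<subseteq> path_image c \<union> disc H"
    by blast
  have "path_image c \<subseteq> H" "H \<subseteq> G \<union> path_image c"
    using H(1) arcs(2) unfolding G1_def G2_def by blast+
  moreover have "inside H \<subseteq> inside G"
    using H(1) crosscut_inside_Un[OF cut] unfolding G1_def G2_def arcs(2) by blast
  moreover have "closed_curve H"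
    using H(1) crosscut_complementary_arcs[OF cut] closed_curve_Un_complementary_arcs
    unfolding G1_def G2_def by blast
  ultimately have "pushed_off G (path_image c) S H"
    using H(2) inside_no_overlap[of H] unfolding pushed_off_def by blast
  then show ?thesis ..
qed

lemma push_off_arc:
  assumes G: "closed_curve G" and c: "arc c" "pathstart c \<notin> inside G" "pathfinish c \<notin> inside G"
    and "arc_interior c \<inter> G = {}"
    and S: "inseparable_by (path_image c) S" "\<And>B. B \<in> S \<Longrightarrow> B \<subseteq> disc G"
  shows "\<exists>G'. pushed_off G (path_image c) S G'"
proof -
  consider "arc_interior c \<subseteq> inside G" | "arc_interior c \<subseteq> outside G"
    using connected_inside_or_outside[OF connected_arc_interior[OF c(1)] assms(5)] by blast
  then show ?thesis
  proof cases
    case 1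
    have "closure (arc_interior c) \<subseteq> disc G"
      using closed_disc_closed_curve[OF G] 1 by (intro closure_minimal) auto
    then have "path_image c \<subseteq> disc G"
      using path_image_subset_closure_arc_interior[OF c(1)] by blast
    then have "pathstart c \<in> G" "pathfinish c \<in> G"
      using c(2,3) by blast+
    then show ?thesis using push_off_crosscut[OF G c(1)] 1 S by blast
  next
    case 2
    then have "path_image c \<inter> inside G = {}"
      using c(2,3) inside_Int_outside[of G] unfolding arc_interior_def by blast
    then have "pushed_off G (path_image c) S G" using G S(2) by (auto simp: pushed_off_def)
    then show ?thesis ..
  qed
qed

definition subdivision :: "'a::topological_space set \<Rightarrow> 'a set \<Rightarrow> (real \<Rightarrow> 'a) set \<Rightarrow> bool" where
  "subdivision X F C \<longleftrightarrow> finite C \<and> X = (\<Union>c\<in>C. path_image c) \<and>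
     (\<forall>c\<in>C. arc c \<and> pathstart c \<in> F \<and> pathfinish c \<in> F \<and> arc_interior c \<inter> F = {}) \<and>
     pairwise (\<lambda>c d. disjnt (arc_interior c) (arc_interior d)) C"

lemma subdivisionD:
  assumes "subdivision X F C"
  shows "finite C" "X = (\<Union>c\<in>C. path_image c)" "\<And>c. c \<in> C \<Longrightarrow> arc c"
    "\<And>c. c \<in> C \<Longrightarrow> pathstart c \<in> F" "\<And>c. c \<in> C \<Longrightarrow> pathfinish c \<in> F"
    "\<And>c. c \<in> C \<Longrightarrow> arc_interior c \<inter> F = {}"
    "\<And>c d. c \<in> C \<Longrightarrow> d \<in> C \<Longrightarrow> c \<noteq> d \<Longrightarrow> disjnt (arc_interior c) (arc_interior d)"
  using assms by (auto simp: subdivision_def pairwise_def)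

lemma arc_subdivision:
  fixes c :: "real \<Rightarrow> 'a::real_normed_vector"
  assumes c: "arc c" and x: "x \<in> arc_interior c"
  shows "\<exists>C. subdivision (path_image c) {pathstart c, pathfinish c, x} C"
proof -
  have "x \<in> c ` {0<..<1}"
    using x simple_path_endless[OF arc_imp_simple_path[OF c]] by (simp add: arc_interior_def)
  then obtain u where u: "0 < u" "u < 1" "c u = x" by auto
  define c1 c2 where "c1 = subpath 0 u c" and "c2 = subpath u 1 c"
  have arcs: "arc c1" "arc c2" using u arc_subpath_arc[OF c] by (auto simp: c1_def c2_def)
  have ends: "pathstart c1 = pathstart c" "pathfinish c1 = x"
    "pathstart c2 = x" "pathfinish c2 = pathfinish c"
    using u(3) by (simp_all add: c1_def c2_def) (simp_all add: pathstart_def pathfinish_def)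
  have images: "path_image c1 = c ` {0..u}" "path_image c2 = c ` {u..1}"
    using u by (simp_all add: c1_def c2_def path_image_subpath)
  have "{0..u} \<union> {u..1} = {0..1::real}" "{0..u} \<inter> {u..1} = {u}" using u by auto
  moreover have "c ` ({0..u} \<inter> {u..1}) = c ` {0..u} \<inter> c ` {u..1}"
    by (rule inj_on_image_Int[OF arc_imp_inj_on[OF c]]) (use u in auto)
  ultimately have halves: "path_image c1 \<union> path_image c2 = path_image c"
    "path_image c1 \<inter> path_image c2 = {x}"
    using u(3) unfolding images path_image_def[of c] image_Un[symmetric] by simp_all
  moreover have "arc_interior c1 \<inter> {pathstart c, pathfinish c, x} = {}"
    "arc_interior c2 \<inter> {pathstart c, pathfinish c, x} = {}"
    using halves(2) ends pathstart_in_path_image[of c1] pathfinish_in_path_image[of c2]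
    by (auto simp: arc_interior_def)
  ultimately have "subdivision (path_image c) {pathstart c, pathfinish c, x} {c1, c2}"
    using arcs ends by (auto simp: subdivision_def pairwise_insert disjnt_def arc_interior_def)
  then show ?thesis ..
qed

lemma subdivision_refine:
  assumes C: "subdivision X F C" and c: "c \<in> C" and D: "subdivision (path_image c) E D"
    and E: "{pathstart c, pathfinish c} \<subseteq> E" "E \<subseteq> path_image c"
  shows "subdivision X (F \<union> E) (D \<union> (C - {c}))"
  unfolding subdivision_def
proof (intro conjI ballI)
  note coarse = subdivisionD[OF C] and fine = subdivisionD[OF D]
  show "finite (D \<union> (C - {c}))" using coarse(1) fine(1) by simp
  show "X = (\<Union>d\<in>D \<union> (C - {c}). path_image d)"
    using coarse(2) fine(2) c by blast
  have inside: "arc_interior d \<subseteq> arc_interior c" if "d \<in> D" for d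
    using fine(2,6) that E(1) unfolding arc_interior_def by blast
  have E_sub: "E \<subseteq> arc_interior c \<union> F"
    using E(2) coarse(4,5)[OF c] unfolding arc_interior_def by blast
  fix d assume "d \<in> D \<union> (C - {c})"
  then consider "d \<in> D" | "d \<in> C - {c}" by blast
  note d_cases = this
  show "arc d" by (cases rule: d_cases) (use coarse(3) fine(3) in auto)
  show "pathstart d \<in> F \<union> E" by (cases rule: d_cases) (use coarse(4) fine(4) in auto)
  show "pathfinish d \<in> F \<union> E" by (cases rule: d_cases) (use coarse(5) fine(5) in auto)
  show "arc_interior d \<inter> (F \<union> E) = {}"
  proof (cases rule: d_cases)
    case 1
    then show ?thesis using fine(6)[of d] inside[of d] coarse(6)[OF c] by blast
  next
    case 2
    then show ?thesis using coarse(6)[of d] coarse(7)[of d c] c E_sub unfolding disjnt_def by blast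
  qed
next
  note coarse = subdivisionD[OF C] and fine = subdivisionD[OF D]
  have "disjnt (arc_interior d) (arc_interior e)" if "d \<in> D" "e \<in> C - {c}" for d e
  proof -
    have "arc_interior d \<subseteq> arc_interior c"
      using fine(2) fine(6)[OF that(1)] that(1) E(1) unfolding arc_interior_def by blast
    moreover have "disjnt (arc_interior c) (arc_interior e)"
      using coarse(7)[of c e] c that(2) by auto
    ultimately show ?thesis by (meson disjnt_subset1)
  qed
  then show "pairwise (\<lambda>c d. disjnt (arc_interior c) (arc_interior d)) (D \<union> (C - {c}))"
    using coarse(7) fine(7) by (auto simp: pairwise_def disjnt_sym)
qed

lemma subdivision_insert:
  fixes X :: "'a::real_normed_vector set"
  assumes C: "subdivision X F C" and "x \<in> X"
  shows "\<exists>C'. subdivision X (insert x F) C'"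
proof (cases "x \<in> F")
  case True
  then show ?thesis using C by (auto simp: insert_absorb)
next
  case False
  note D = subdivisionD[OF C]
  obtain c where "c \<in> C" "x \<in> path_image c" using D(2) \<open>x \<in> X\<close> by blast
  then have c: "c \<in> C" "x \<in> arc_interior c" "arc c"
    using D(3-5) False by (auto simp: arc_interior_def)
  obtain C' where "subdivision (path_image c) {pathstart c, pathfinish c, x} C'"
    using arc_subdivision[OF c(3,2)] by blast
  then have "subdivision X (F \<union> {pathstart c, pathfinish c, x}) (C' \<union> (C - {c}))"
    using c(2) by (intro subdivision_refine[OF C c(1)]) (auto simp: arc_interior_def)
  moreover have "F \<union> {pathstart c, pathfinish c, x} = insert x F" using D(4,5)[OF c(1)] by blast
  ultimately show ?thesis by auto
qed

lemma closed_curve_subdivision: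
  assumes X: "closed_curve X" and F: "finite F" "F \<subseteq> X" and ab: "a \<in> X" "b \<in> X" "a \<noteq> b"
  shows "\<exists>C. subdivision X (F \<union> {a, b}) C"
  using F
proof (induction F rule: finite_induct)
  case empty
  obtain c d where "complementary_arcs c d a b" "path_image c \<union> path_image d = X"
    using closed_curve_complementary_arcsE[OF X ab] .
  then have "subdivision X ({} \<union> {a, b}) {c, d}"
    by (auto simp: subdivision_def complementary_arcs_def arc_interior_def pairwise_insert
        disjnt_def)
  then show ?case ..
next
  case (insert x F)
  then show ?case using subdivision_insert[of X "F \<union> {a, b}" _ x] by (auto simp: insert_commute)
qed

lemma push_off_disjoint_arcs:
  assumes G: "closed_curve G" and "finite C"
    and C: "\<And>c. c \<in> C \<Longrightarrow> arc c" "\<And>c. c \<in> C \<Longrightarrow> pathstart c \<notin> inside G"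
      "\<And>c. c \<in> C \<Longrightarrow> pathfinish c \<notin> inside G" "\<And>c. c \<in> C \<Longrightarrow> arc_interior c \<inter> G = {}"
      "\<And>c d. c \<in> C \<Longrightarrow> d \<in> C \<Longrightarrow> c \<noteq> d \<Longrightarrow> arc_interior c \<inter> path_image d = {}"
    and S: "inseparable_by (\<Union>c\<in>C. path_image c) S" "\<And>B. B \<in> S \<Longrightarrow> B \<subseteq> disc G"
  shows "\<exists>G'. pushed_off G (\<Union>c\<in>C. path_image c) S G'"
  using \<open>finite C\<close> C S(1)
proof (induction C rule: finite_induct)
  case empty
  have "pushed_off G {} S G" using G S(2) by (simp add: pushed_off_def)
  then show ?case by auto
next
  case (insert c C)
  have "inseparable_by (\<Union>c\<in>C. path_image c) S" "inseparable_by (path_image c) S"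
    by (rule inseparable_by_subset[OF insert.prems(6)]; auto)+
  moreover from this obtain H where H: "pushed_off G (\<Union>c\<in>C. path_image c) S H"
    using insert.IH insert.prems(1-5) by auto
  moreover have "arc_interior c \<inter> path_image d = {}" if "d \<in> C" for d
    using insert.prems(5)[of c d] insert.hyps(2) that by auto
  then have "arc_interior c \<inter> (G \<union> (\<Union>d\<in>C. path_image d)) = {}"
    using insert.prems(4)[of c] by auto
  then have "arc_interior c \<inter> H = {}" using pushed_offD(2)[OF H] by blast
  moreover have "pathstart c \<notin> inside H" "pathfinish c \<notin> inside H"
    using insert.prems(2,3)[of c] pushed_offD(3)[OF H] by auto
  ultimately obtain G' where "pushed_off H (path_image c) S G'"
    using push_off_arc[of H c S] insert.prems(1)[of c] pushed_offD(1,5)[OF H] by auto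
  then have "pushed_off G ((\<Union>c\<in>C. path_image c) \<union> path_image c) S G'"
    by (rule pushed_off_trans[OF H])
  then show ?case by (auto simp: Un_commute)
qed

lemma push_off_curve:
  assumes G: "closed_curve G" and X: "closed_curve X" "finite (X \<inter> G)"
    and ab: "a \<in> X" "b \<in> X" "a \<noteq> b" "a \<notin> inside G" "b \<notin> inside G"
    and S: "inseparable_by X S" "\<And>B. B \<in> S \<Longrightarrow> B \<subseteq> disc G"
  shows "\<exists>G'. pushed_off G X S G'"
proof -
  obtain C where C: "subdivision X (X \<inter> G \<union> {a, b}) C"
    using closed_curve_subdivision[OF X _ ab(1-3)] by blast
  note D = subdivisionD[OF C]
  have not_inside: "p \<notin> inside G" if "p \<in> X \<inter> G \<union> {a, b}" for p
    using that ab(4,5) inside_no_overlap[of G] by blast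
  have "\<exists>G'. pushed_off G (\<Union>c\<in>C. path_image c) S G'"
  proof (rule push_off_disjoint_arcs[OF G D(1,3)])
    show "arc_interior c \<inter> G = {}" if "c \<in> C" for c
      using D(2,6) that unfolding arc_interior_def by blast
    show "arc_interior c \<inter> path_image d = {}" if "c \<in> C" "d \<in> C" "c \<noteq> d" for c d
    proof -
      have "path_image d \<subseteq> arc_interior d \<union> (X \<inter> G \<union> {a, b})"
        using D(4,5)[OF that(2)] by (auto simp: arc_interior_def)
      then show ?thesis using D(6)[OF that(1)] D(7)[OF that] unfolding disjnt_def by blast
    qed
  qed (use D(2,4,5) S not_inside in auto)
  then show ?thesis using D(2) by simp
qed

section \<open>Pairwise touching curves\<close>

lemma general_position_finite_Int:
  "general_position S \<Longrightarrow> A \<in> S \<Longrightarrow> B \<in> S \<Longrightarrow> A \<noteq> B \<Longrightarrow> finite (A \<inter> B)"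
  by (simp add: general_position_def)

lemma general_position_no_triple_point:
  "general_position S \<Longrightarrow> A \<in> S \<Longrightarrow> B \<in> S \<Longrightarrow> C \<in> S \<Longrightarrow> distinct [A, B, C] \<Longrightarrow> A \<inter> B \<inter> C = {}"
  by (simp add: general_position_def)

lemma general_position_subset: "general_position T \<Longrightarrow> S \<subseteq> T \<Longrightarrow> general_position S"
  unfolding general_position_def by (meson subsetD)

lemma general_position_image:
  assumes "inj f" and S: "general_position S"
  shows "general_position ((`) f ` S)"
proof -
  have Int: "f ` A \<inter> f ` B = f ` (A \<inter> B)" for A B
    using image_Int[OF assms(1)] by metis
  show ?thesis
    using S by (simp add: general_position_def Int) (metis finite_imageI)
qed

definition meet :: "complex set \<Rightarrow> complex set \<Rightarrow> complex" where
  "meet A B = the_elem (A \<inter> B)"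

lemma meet_commute: "meet A B = meet B A"
  by (simp add: meet_def Int_commute)

locale pairwise_touching =
  fixes S :: "complex set set"
  assumes curves: "A \<in> S \<Longrightarrow> closed_curve A"
    and general: "general_position S"
    and single: "A \<in> S \<Longrightarrow> B \<in> S \<Longrightarrow> A \<noteq> B \<Longrightarrow> \<exists>p. A \<inter> B = {p}"
begin

lemma Int_eq_meet:
  assumes "A \<in> S" "B \<in> S" "A \<noteq> B"
  shows "A \<inter> B = {meet A B}"
proof -
  obtain p where "A \<inter> B = {p}" using single[OF assms] ..
  then show ?thesis by (simp add: meet_def)
qed

lemma meet_in:
  assumes "A \<in> S" "B \<in> S" "A \<noteq> B"
  shows "meet A B \<in> A" "meet A B \<in> B"
  using Int_eq_meet[OF assms] by auto

lemma meet_notin: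
  assumes "A \<in> S" "B \<in> S" "C \<in> S" "distinct [A, B, C]"
  shows "meet A B \<notin> C"
  using general meet_in[of A B] assms unfolding general_position_def by auto

lemma meet_neq:
  assumes "A \<in> S" "B \<in> S" "C \<in> S" "distinct [A, B, C]"
  shows "meet A B \<noteq> meet A C"
  using meet_notin[OF assms] meet_in[of A C] assms by auto

lemma inseparable:
  assumes "A \<in> S"
  shows "inseparable_by A (S - {A})"
proof -
  have "\<not> B \<inter> C \<subseteq> A" if "B \<in> S - {A}" "C \<in> S - {A}" "B \<noteq> C" for B C
    using Int_eq_meet[of B C] meet_notin[of B C A] that assms by auto
  moreover have "\<exists>p. B \<inter> A \<subseteq> {p}" if "B \<in> S - {A}" for B
    using single[of B A] that assms by auto
  ultimately show ?thesis
    using curves by (simp add: inseparable_by_def)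
qed

lemma path_connected_Un_Diff:
  assumes "B \<in> S" "C \<in> S" "D \<in> S" "distinct [B, C, D]"
  shows "path_connected (B \<union> D - C)"
proof -
  have "B - C = B - {meet B C}" "D - C = D - {meet D C}"
    using Int_eq_meet[of B C] Int_eq_meet[of D C] assms by auto
  then have "path_connected (B - C)" "path_connected (D - C)"
    using path_connected_closed_curve_delete curves assms(1,3) by simp_all
  moreover have "meet B D \<in> (B - C) \<inter> (D - C)"
    using meet_in[of B D] meet_notin[of B D C] assms by auto
  ultimately show ?thesis
    unfolding Un_Diff using path_connected_Un by blast
qed

lemma interlaced_meet_transfer:
  assumes S: "A \<in> S" "B \<in> S" "C \<in> S" "D \<in> S" "E \<in> S" and distinct: "distinct [A, B, C, D, E]"
    and int: "interlaced A (meet A B) (meet A D) (meet A C) (meet A E)"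
  shows "interlaced E (meet E B) (meet E D) (meet E A) (meet E C)"
proof -
  have neq: "A \<noteq> B" "A \<noteq> C" "A \<noteq> D" "A \<noteq> E" "B \<noteq> C" "B \<noteq> D" "B \<noteq> E" "C \<noteq> D" "C \<noteq> E" "D \<noteq> E"
    using distinct by simp_all
  have "\<not> connected_component (E - {meet E B, meet E D}) (meet E A) (meet E C)"
  proof
    assume "connected_component (E - {meet E B, meet E D}) (meet E A) (meet E C)"
    then obtain Q where Q: "connected Q" "Q \<subseteq> E - {meet E B, meet E D}"
        "meet E A \<in> Q" "meet E C \<in> Q"
      by (auto simp: connected_component_def)
    obtain K where K: "K \<in> closed_sides A" "\<forall>B\<in>S - {A}. B \<subseteq> K"
      using inseparable_by_closed_curve[OF inseparable[OF S(1)]] by blast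
    have "path_connected (B \<union> D - C)"
      using path_connected_Un_Diff[of B C D] S neq by simp
    moreover have "meet A B \<in> B \<union> D - C" "meet A D \<in> B \<union> D - C"
      using meet_in(2)[of A B] meet_in(2)[of A D] meet_notin[of A B C]
        meet_notin[of A D C] S neq by simp_all
    ultimately have "path_component (B \<union> D - C) (meet A B) (meet A D)"
      unfolding path_connected_component by blast
    moreover have "connected_component (C \<union> Q) (meet A C) (meet A E)"
    proof -
      have "meet E C \<in> C" "meet A C \<in> C" "E \<noteq> A"
        using meet_in(2)[of E C] meet_in(2)[of A C] S neq by simp_all
      then have "connected (C \<union> Q)" "meet A C \<in> C \<union> Q" "meet A E \<in> C \<union> Q"
        using Q closed_curve_imp_connected[OF curves[OF S(3)]] connected_Un[of C Q]
        by (auto simp: meet_commute[of A E])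
      then show ?thesis unfolding connected_component_def by blast
    qed
    moreover have "B \<subseteq> K" "C \<subseteq> K" "D \<subseteq> K" "E \<subseteq> K"
      using K(2) S neq by auto
    then have "B \<union> D - C \<subseteq> K" "C \<union> Q \<subseteq> K" using Q(2) by blast+
    ultimately have "(B \<union> D - C) \<inter> (C \<union> Q) \<noteq> {}"
      by (intro interlaced_chords_intersect[OF curves[OF S(1)] K(1) int])
    then obtain x where "x \<in> Q" "x \<in> B \<or> x \<in> D" by blast
    moreover have "E \<inter> B = {meet E B}" "E \<inter> D = {meet E D}"
      using Int_eq_meet S neq by simp_all
    ultimately show False using Q(2) by blast
  qed
  then show ?thesis
    using meet_in(1)[of E] meet_neq[of E] S neq by (simp add: interlaced_def)
qed

text \<open>Writing \<open>X: B D | C E\<close> for interlacing touching points on \<open>X\<close>, the pattern \<open>A: B D | C E\<close>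
  forces \<open>E: B D | A C\<close> and \<open>B: C E | A D\<close>; the latter forces \<open>E: A D | B C\<close>.\<close>

lemma not_interlaced_meet:
  assumes S: "A \<in> S" "B \<in> S" "C \<in> S" "D \<in> S" "E \<in> S" and distinct: "distinct [A, B, C, D, E]"
  shows "\<not> interlaced A (meet A B) (meet A D) (meet A C) (meet A E)"
proof
  assume A: "interlaced A (meet A B) (meet A D) (meet A C) (meet A E)"
  have E: "interlaced E (meet E B) (meet E D) (meet E A) (meet E C)"
    using interlaced_meet_transfer[OF S distinct A] .
  have perms: "distinct [A, C, D, E, B]" "distinct [B, A, C, D, E]"
    using distinct by (simp; blast)+
  have "interlaced A (meet A C) (meet A E) (meet A D) (meet A B)"
    using A interlaced_sym[OF curves[OF S(1)]] interlaced_swap_left interlaced_swap_right by blast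
  then have "interlaced B (meet B C) (meet B E) (meet B A) (meet B D)"
    by (rule interlaced_meet_transfer[OF S(1,3,4,5,2) perms(1)])
  then have "interlaced B (meet B A) (meet B D) (meet B C) (meet B E)"
    using interlaced_sym[OF curves[OF S(2)]] by blast
  then have "interlaced E (meet E A) (meet E D) (meet E B) (meet E C)"
    by (rule interlaced_meet_transfer[OF S(2,1,3,4,5) perms(2)])
  then have "interlaced E (meet E D) (meet E A) (meet E C) (meet E B)"
    using interlaced_swap_left interlaced_swap_right by blast
  moreover have "interlaced E (meet E D) (meet E B) (meet E C) (meet E A)"
    using E interlaced_swap_left interlaced_swap_right by blast
  ultimately show False
    using interlaced_exclusive[OF curves[OF S(5)]] by blast
qed

theorem card_le_4:
  assumes "finite S"
  shows "card S \<le> 4"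
proof (rule ccontr)
  assume "\<not> ?thesis"
  then have "5 \<le> card S" by simp
  then obtain T where T: "T \<subseteq> S" "card T = 5"
    using obtain_subset_with_card_n by metis
  then obtain xs where xs: "set xs = T" "distinct xs"
    using finite_distinct_list finite_subset[OF T(1) assms] by blast
  then have "length xs = 5" using T(2) distinct_card by metis
  then obtain A B C D E where list: "xs = [A, B, C, D, E]"
    by (auto simp: eval_nat_numeral length_Suc_conv)
  have "set [A, B, C, D, E] \<subseteq> S" and distinct: "distinct [A, B, C, D, E]"
    using xs T(1) unfolding list by simp_all
  then have S: "A \<in> S" "B \<in> S" "C \<in> S" "D \<in> S" "E \<in> S" by simp_all
  have "distinct [A, B, D, C, E]" "distinct [A, B, C, E, D]"
    using distinct by (simp; blast)+
  then have none: "\<not> interlaced A (meet A B) (meet A D) (meet A C) (meet A E)"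
    "\<not> interlaced A (meet A B) (meet A C) (meet A D) (meet A E)"
    "\<not> interlaced A (meet A B) (meet A E) (meet A C) (meet A D)"
    using not_interlaced_meet S distinct by blast+
  have neq: "A \<noteq> B" "A \<noteq> C" "A \<noteq> D" "A \<noteq> E" "B \<noteq> C" "B \<noteq> D" "B \<noteq> E" "C \<noteq> D" "C \<noteq> E" "D \<noteq> E"
    using distinct by simp_all
  have "{meet A B, meet A C, meet A D, meet A E} \<subseteq> A"
    "distinct [meet A B, meet A C, meet A D, meet A E]"
    using meet_in(1)[of A] meet_neq[of A] S neq by simp_all
  from interlaced_cases[OF curves[OF S(1)] this] show False
    using none by blast
qed

end

section \<open>Two touching families\<close>

locale touching_families =
  fixes S1 S2 :: "complex set set"
  assumes finite_families: "finite S1" "finite S2"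
    and closed_curves: "A \<in> S1 \<union> S2 \<Longrightarrow> closed_curve A"
    and gen_pos: "general_position (S1 \<union> S2)"
    and meets: "A \<in> S1 \<union> S2 \<Longrightarrow> B \<in> S1 \<union> S2 \<Longrightarrow> A \<inter> B \<noteq> {}"
    and meets_once: "A \<in> S1 \<Longrightarrow> B \<in> S2 \<Longrightarrow> \<exists>p. A \<inter> B = {p}"
begin

lemma general_position_families: "general_position S1" "general_position S2"
  using general_position_subset[OF gen_pos] by blast+

lemmas no_triple_point = general_position_no_triple_point[OF gen_pos]

lemma families_disjoint: "S1 \<inter> S2 = {}"
proof (rule ccontr)
  assume "S1 \<inter> S2 \<noteq> {}"
  then obtain A where A: "A \<in> S1" "A \<in> S2" by blast
  then obtain p where "A = {p}" using meets_once[OF A] by auto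
  then show False using closed_curve_not_subset_singleton[of A p] closed_curves A(1) by simp
qed

lemma inseparable_right:
  assumes "A \<in> S1"
  shows "inseparable_by A S2"
proof -
  have "\<not> B \<inter> C \<subseteq> A" if BC: "B \<in> S2" "C \<in> S2" "B \<noteq> C" for B C
  proof -
    have "A \<noteq> B" "A \<noteq> C" using BC assms families_disjoint by auto
    then have "A \<inter> B \<inter> C = {}" using BC assms by (intro no_triple_point) auto
    moreover have "B \<inter> C \<noteq> {}" using meets[of B C] BC by simp
    ultimately show ?thesis by blast
  qed
  moreover have "\<exists>p. B \<inter> A \<subseteq> {p}" if "B \<in> S2" for B
    using meets_once[OF assms that] by blast
  ultimately show ?thesis
    using closed_curves by (simp add: inseparable_by_def)
qed

definition separates :: "complex set \<Rightarrow> complex set set \<Rightarrow> bool" where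
  "separates G F \<longleftrightarrow> closed_curve G \<and> G \<subseteq> \<Union>F \<and> \<Union>F \<inter> inside G = {} \<and> (\<forall>B\<in>S2. B \<subseteq> disc G)"

lemma separates_insert:
  assumes G: "separates G F" and F: "finite F" "F \<subseteq> S1" and X: "X \<in> S1 - F"
    and ab: "a \<in> X \<inter> \<Union>F" "b \<in> X \<inter> \<Union>F" "a \<noteq> b"
  shows "\<exists>G'. separates G' (insert X F)"
proof -
  have sep: "closed_curve G" "G \<subseteq> \<Union>F" "\<Union>F \<inter> inside G = {}" "\<And>B. B \<in> S2 \<Longrightarrow> B \<subseteq> disc G"
    using G by (simp_all add: separates_def)
  have "finite (X \<inter> A)" if "A \<in> F" for A
    using that F(2) X by (intro general_position_finite_Int[OF gen_pos]) auto
  then have "finite (\<Union>A\<in>F. X \<inter> A)" using F(1) by (rule finite_UN_I[rotated])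
  moreover have "X \<inter> G \<subseteq> (\<Union>A\<in>F. X \<inter> A)" using sep(2) by blast
  ultimately have "finite (X \<inter> G)" by (rule rev_finite_subset)
  moreover have "a \<notin> inside G" "b \<notin> inside G" using sep(3) ab(1,2) by blast+
  ultimately obtain G' where "pushed_off G X S2 G'"
    using push_off_curve[of G X a b S2] sep(1,4) X ab inseparable_right[of X] closed_curves[of X]
    by auto
  note G' = pushed_offD[OF this]
  have "G' \<subseteq> \<Union>(insert X F)" "\<Union>(insert X F) \<inter> inside G' = {}"
    using G'(2-4) sep(2,3) by auto
  then have "separates G' (insert X F)" using G'(1,5) by (simp add: separates_def)
  then show ?thesis ..
qed

lemma ex_separating_curve:
  assumes XY: "X \<in> S1" "Y \<in> S1" "X \<noteq> Y" and ab: "a \<in> X \<inter> Y" "b \<in> X \<inter> Y" "a \<noteq> b"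
    and inX: "\<And>B. B \<in> S2 \<Longrightarrow> B \<subseteq> disc X"
  shows "\<exists>G. separates G S1"
proof -
  have "\<exists>G. separates G ({X, Y} \<union> F)" if "finite F" "F \<subseteq> S1 - {X, Y}" for F
    using that
  proof (induction F rule: finite_induct)
    case empty
    have "X \<inter> inside X = {}" using inside_no_overlap[of X] by blast
    then have "separates X {X}" using XY(1) inX closed_curves by (simp add: separates_def)
    then show ?case using separates_insert[of X "{X}" Y a b] XY ab by (auto simp: insert_commute)
  next
    case (insert Z F)
    then obtain G where G: "separates G ({X, Y} \<union> F)" by auto
    obtain c d where cd: "c \<in> Z \<inter> X" "d \<in> Z \<inter> Y"
      using meets[of Z X] meets[of Z Y] insert.prems XY by auto
    have "Z \<inter> X \<inter> Y = {}" using insert.prems XY by (intro no_triple_point) auto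
    then have "c \<noteq> d" using cd by auto
    then show ?case
      using separates_insert[OF G, of Z c d] cd insert.hyps insert.prems XY by auto
  qed
  from this[of "S1 - {X, Y}"] show ?thesis
    using finite_families XY by (simp add: insert_absorb insert_Diff_if Un_absorb1)
qed

end

section \<open>Alternations and intersection points\<close>

lemma card_image_le_factor:
  assumes "finite (l ` U)" and factor: "\<And>s t. s \<in> U \<Longrightarrow> t \<in> U \<Longrightarrow> l s = l t \<Longrightarrow> f s = f t"
  shows "finite (f ` U) \<and> card (f ` U) \<le> card (l ` U)"
proof -
  have "f t = f (inv_into U l (l t))" if "t \<in> U" for t
    using factor[of t "inv_into U l (l t)"] that by (simp add: inv_into_into f_inv_into_f)
  then have "f ` U = (f \<circ> inv_into U l) ` l ` U" by (auto simp: image_comp)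
  then show ?thesis using assms(1) card_image_le[of "l ` U" "f \<circ> inv_into U l"] by simp
qed

lemma card_path_components_path_image_Diff:
  fixes h :: "real \<Rightarrow> 'a::topological_space"
  assumes h: "path h" and fin: "finite {t \<in> {0..1}. h t \<in> Y}"
  shows "finite (path_component_set (path_image h - Y) ` (path_image h - Y))"
    and "card (path_component_set (path_image h - Y) ` (path_image h - Y))
      \<le> card {t \<in> {0..1}. h t \<in> Y} + 1"
proof -
  let ?X = "path_image h - Y"
  define T U where "T = {t \<in> {0..1}. h t \<in> Y}" and "U = {t \<in> {0..1}. h t \<notin> Y}"
  define l where "l t = card {s \<in> T. s < t}" for t
  have "finite T" using fin by (simp add: T_def)
  have connected: "path_component ?X (h s) (h t)"
    if st: "s \<in> U" "t \<in> U" "l s = l t" "s \<le> t" for s t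
  proof -
    have same: "{r \<in> T. r < s} = {r \<in> T. r < t}"
      using st(3,4) \<open>finite T\<close> unfolding l_def by (intro card_subset_eq) auto
    have "r \<notin> T" if "r \<in> {s..t}" for r
    proof
      assume "r \<in> T"
      then have "r \<noteq> t" using st(2) by (auto simp: T_def U_def)
      then have "r \<in> {r \<in> T. r < t}" using \<open>r \<in> T\<close> that by auto
      then show False using that unfolding same[symmetric] by simp
    qed
    then have "h ` {s..t} \<subseteq> ?X" using st(1,2) by (auto simp: T_def U_def path_image_def)
    moreover have "path_connected (h ` {s..t})"
      using st(1,2) h by (intro path_connected_continuous_image continuous_on_path[OF h]
          convex_imp_path_connected) (auto simp: U_def)
    then have "path_component (h ` {s..t}) (h s) (h t)"
      using st(4) by (simp add: path_connected_component)
    ultimately show ?thesis by (rule path_component_of_subset)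
  qed
  have same_component: "path_component_set ?X (h s) = path_component_set ?X (h t)"
    if "s \<in> U" "t \<in> U" "l s = l t" for s t
    using connected[of s t] connected[of t s] that path_component_eq[of "h t" ?X "h s"]
      path_component_eq[of "h s" ?X "h t"] by (cases s t rule: linorder_le_cases) auto
  have "l ` U \<subseteq> {..card T}"
    using \<open>finite T\<close> by (auto simp: l_def intro!: card_mono)
  then have l: "finite (l ` U)" "card (l ` U) \<le> card T + 1"
    using finite_subset[of "l ` U" "{..card T}"] card_mono[of "{..card T}" "l ` U"] by simp_all
  have components: "path_component_set ?X ` ?X = (\<lambda>t. path_component_set ?X (h t)) ` U"
    by (auto simp: U_def path_image_def)
  have "finite (path_component_set ?X ` ?X) \<and> card (path_component_set ?X ` ?X) \<le> card (l ` U)"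
    unfolding components by (rule card_image_le_factor[OF l(1) same_component])
  then show "finite (path_component_set ?X ` ?X)"
    "card (path_component_set ?X ` ?X) \<le> card {t \<in> {0..1}. h t \<in> Y} + 1"
    using l(2) unfolding T_def by linarith+
qed

lemma card_path_components_closed_curve_Diff_le:
  assumes X: "closed_curve X" and fin: "finite (X \<inter> Y)" and "P \<subseteq> X - Y"
  shows "card (path_component_set (X - Y) ` P) \<le> card (X \<inter> Y) + 2"
proof -
  obtain h where h: "simple_path h" "path_image h = X" using closed_curveE[OF X] .
  define T where "T = {t \<in> {0..1}. h t \<in> Y}"
  have inj: "inj_on h (T - {1})"
    by (rule inj_onI) (auto simp: T_def intro: simple_path_eqD[OF h(1)])
  have sub: "h ` (T - {1}) \<subseteq> X \<inter> Y" using h(2) by (auto simp: T_def path_image_def)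
  have "finite (T - {1})" by (rule finite_imageD[OF finite_subset[OF sub fin] inj])
  then have T: "finite T" by simp
  have "card T \<le> card (T - {1}) + 1" using card_Suc_Diff1[OF T, of 1] by (cases "1 \<in> T") simp_all
  then have card_T: "card T \<le> card (X \<inter> Y) + 1"
    using card_inj_on_le[OF inj sub fin] by simp
  note components = card_path_components_path_image_Diff
    [OF simple_path_imp_path[OF h(1)] T[unfolded T_def]]
  have "card (path_component_set (X - Y) ` P) \<le> card (path_component_set (X - Y) ` (X - Y))"
    using components(1) \<open>P \<subseteq> X - Y\<close> by (intro card_mono image_mono) (simp_all add: h(2))
  also have "\<dots> \<le> card T + 1" using components(2) by (simp add: h(2) T_def)
  also have "\<dots> \<le> card (X \<inter> Y) + 2" using card_T by simp
  finally show ?thesis .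
qed

definition intersection_count :: "'a set set \<Rightarrow> nat" where
  "intersection_count S = (\<Sum>X\<in>S. \<Sum>Y\<in>S - {X}. card (X \<inter> Y))"

lemma intersection_count_image:
  assumes "inj f"
  shows "intersection_count ((`) f ` S) = intersection_count S"
proof -
  have inj: "inj ((`) f)" using assms by (simp add: inj_on_image_Pow flip: Pow_UNIV)
  have diff: "(`) f ` S - {f ` X} = (`) f ` (S - {X})" for X
    using image_set_diff[OF inj, of S "{X}"] by simp
  show ?thesis
    unfolding intersection_count_def
    by (simp add: sum.reindex inj_on_subset[OF inj] diff image_Int[OF assms, symmetric]
        card_image inj_on_subset[OF assms])
qed

context
  fixes g :: "real \<Rightarrow> complex" and K :: "complex set" and \<tau> :: "nat \<Rightarrow> real" and N :: nat
  assumes g: "simple_path g" "pathfinish g = pathstart g"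
    and K: "K \<in> closed_sides (path_image g)"
    and \<tau>: "strict_mono_on {..<N} \<tau>" "\<And>t. t < N \<Longrightarrow> 0 \<le> \<tau> t \<and> \<tau> t < 1"
begin

lemma card_alternations_le_card_Int:
  assumes X: "closed_curve X" "X \<subseteq> K" and Y: "closed_curve Y" "Y \<subseteq> K"
    and "X \<noteq> Y" and fin: "finite (X \<inter> Y)"
    and rX: "\<And>t. t < N \<Longrightarrow> r t = X \<Longrightarrow> g (\<tau> t) \<in> X - Y"
    and rY: "\<And>t. t < N \<Longrightarrow> r t = Y \<Longrightarrow> g (\<tau> t) \<in> Y - X"
  shows "card (alternations r N X Y) \<le> 2 * card (X \<inter> Y) + 4"
proof -
  define p where "p t = g (\<tau> t)" for t
  define cX cY where "cX t = path_component_set (X - Y) (p t)"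
    and "cY t = path_component_set (Y - X) (p t)" for t
  have "card (alternations r N X Y)
      \<le> card (cX ` {t. t < N \<and> r t = X}) + card (cY ` {t. t < N \<and> r t = Y})"
  proof (rule card_alternations_le[OF \<open>X \<noteq> Y\<close>])
    fix i j k m
    assume ord: "i < j" "j < k" "k < m" "m < N"
      and r: "r i = X" "r j = Y" "r k = X" "r m = Y" and eq: "cX i = cX k"
    show "cY j \<noteq> cY m"
    proof
      assume "cY j = cY m"
      then have "path_component (X - Y) (p i) (p k)" "path_component (Y - X) (p j) (p m)"
        using eq rX[of k] rY[of m] r ord unfolding cX_def cY_def p_def
        by (metis less_trans mem_Collect_eq path_component_refl)+
      moreover have "interlaced (path_image g) (p i) (p k) (p j) (p m)"
        unfolding p_def using ord \<tau> by (intro interlaced_parametrized[OF g])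
          (auto intro!: strict_mono_onD[OF \<tau>(1)])
      moreover have "connected_component (Y - X) (p j) (p m)"
        using calculation(2) path_component_subset_connected_component[of "Y - X" "p j"] by blast
      ultimately have "(X - Y) \<inter> (Y - X) \<noteq> {}"
        using X(2) Y(2) by (intro interlaced_chords_intersect[OF closed_curveI[OF g] K]) auto
      then show False by blast
    qed
  qed
  also have "\<dots> \<le> (card (X \<inter> Y) + 2) + (card (Y \<inter> X) + 2)"
  proof (rule add_mono)
    show "card (cX ` {t. t < N \<and> r t = X}) \<le> card (X \<inter> Y) + 2"
      using card_path_components_closed_curve_Diff_le[OF X(1) fin, of "p ` {t. t < N \<and> r t = X}"] rX
      by (auto simp: cX_def p_def image_image)
    show "card (cY ` {t. t < N \<and> r t = Y}) \<le> card (Y \<inter> X) + 2"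
      using card_path_components_closed_curve_Diff_le[OF Y(1), of X "p ` {t. t < N \<and> r t = Y}"] rY fin
      by (auto simp: cY_def p_def image_image Int_commute)
  qed
  finally show ?thesis by (simp add: Int_commute)
qed

lemma sum_seen_since_le_intersection_count:
  assumes "finite S" and S: "\<And>X. X \<in> S \<Longrightarrow> closed_curve X \<and> X \<subseteq> K"
      "general_position S"
    and r: "\<And>t. t < N \<Longrightarrow> r t \<in> S" "\<And>t. t < N \<Longrightarrow> g (\<tau> t) \<in> r t"
      "\<And>t X. t < N \<Longrightarrow> X \<in> S \<Longrightarrow> X \<noteq> r t \<Longrightarrow> g (\<tau> t) \<notin> X"
  shows "(\<Sum>t<N. card (seen_since r t)) \<le> 2 * intersection_count S + 4 * (card S)\<^sup>2"
proof -
  have "(\<Sum>t<N. card (seen_since r t)) = (\<Sum>X\<in>S. \<Sum>Y\<in>S - {X}. card (alternations r N X Y))"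
    using r(1) by (intro sum_card_seen_since_eq_alternations \<open>finite S\<close>) auto
  also have "\<dots> \<le> (\<Sum>X\<in>S. \<Sum>Y\<in>S - {X}. 2 * card (X \<inter> Y) + 4)"
  proof (intro sum_mono card_alternations_le_card_Int)
    fix X Y assume "X \<in> S" "Y \<in> S - {X}"
    then show "closed_curve X" "X \<subseteq> K" "closed_curve Y" "Y \<subseteq> K" "X \<noteq> Y" "finite (X \<inter> Y)"
      using S general_position_finite_Int[of S X Y] by auto
    show "g (\<tau> t) \<in> X - Y" if "t < N" "r t = X" for t
      using r(2,3)[OF that(1)] that(2) \<open>Y \<in> S - {X}\<close> by auto
    show "g (\<tau> t) \<in> Y - X" if "t < N" "r t = Y" for t
      using r(2,3)[OF that(1)] that(2) \<open>X \<in> S\<close> \<open>Y \<in> S - {X}\<close> by auto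
  qed
  also have "\<dots> = 2 * intersection_count S + (\<Sum>X\<in>S. 4 * card (S - {X}))"
    by (simp add: intersection_count_def sum.distrib sum_distrib_left mult.commute)
  also have "(\<Sum>X\<in>S. 4 * card (S - {X})) \<le> (\<Sum>X\<in>S. 4 * card S)"
    using card_Diff1_le[of S] by (intro sum_mono) simp
  also have "\<dots> = 4 * (card S)\<^sup>2" by (simp add: power2_eq_square)
  finally show ?thesis by simp
qed

end

lemma ex_strict_mono_enumeration:
  fixes \<sigma> :: "'a \<Rightarrow> 'b::linorder"
  assumes "finite I" and inj: "inj_on \<sigma> I"
  obtains e where "bij_betw e {..<card I} I" "strict_mono_on {..<card I} (\<sigma> \<circ> e)"
proof -
  define xs where "xs = sorted_list_of_set (\<sigma> ` I)"
  have xs: "set xs = \<sigma> ` I" "distinct xs" "length xs = card I" "sorted_wrt (<) xs"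
    using \<open>finite I\<close> by (simp_all add: xs_def card_image[OF inj] strict_sorted_list_of_set)
  define e where "e = inv_into I \<sigma> \<circ> (!) xs"
  have "bij_betw ((!) xs) {..<card I} (\<sigma> ` I)"
    using bij_betw_nth[OF xs(2), of "{..<card I}" "\<sigma> ` I"] xs(1,3) by simp
  then have "bij_betw e {..<card I} I"
    unfolding e_def using bij_betw_inv_into[OF inj_on_imp_bij_betw[OF inj]] by (rule bij_betw_trans)
  moreover have "\<sigma> (e t) = xs ! t" if "t < card I" for t
    using nth_mem[of t xs] xs(1,3) that by (simp add: e_def f_inv_into_f)
  then have "strict_mono_on {..<card I} (\<sigma> \<circ> e)"
    using xs(3,4) by (auto intro!: strict_mono_onI simp: sorted_wrt_nth_less)
  ultimately show thesis using that by blast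
qed

section \<open>Intersection points of two touching families\<close>

context touching_families
begin

lemma ex_touching_parameters:
  assumes G: "separates G S1" and g: "path_image g = G" "pathfinish g = pathstart g"
  shows "\<exists>\<sigma>. inj_on \<sigma> (S1 \<times> S2) \<and>
    (\<forall>A\<in>S1. \<forall>B\<in>S2. 0 \<le> \<sigma> (A, B) \<and> \<sigma> (A, B) < 1 \<and> g (\<sigma> (A, B)) \<in> A \<inter> B)"
proof -
  have "\<exists>t. 0 \<le> t \<and> t < 1 \<and> g t \<in> A \<inter> B" if AB: "A \<in> S1" "B \<in> S2" for A B
  proof -
    obtain x where x: "x \<in> A \<inter> B" using meets[of A B] AB by auto
    then have "x \<in> path_image g" using G AB g(1) unfolding separates_def by blast
    then obtain t where t: "0 \<le> t" "t \<le> 1" "g t = x" by (auto simp: path_image_def)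
    show ?thesis
    proof (cases "t = 1")
      case True
      then have "g 0 = x" using t(3) g(2) by (simp add: pathstart_def pathfinish_def)
      then show ?thesis using x by (intro exI[of _ 0]) simp
    next
      case False
      then show ?thesis using x t by (intro exI[of _ t]) simp
    qed
  qed
  then obtain \<sigma> where
    \<sigma>: "\<And>A B. A \<in> S1 \<Longrightarrow> B \<in> S2 \<Longrightarrow> 0 \<le> \<sigma> A B \<and> \<sigma> A B < 1 \<and> g (\<sigma> A B) \<in> A \<inter> B"
    by metis
  have "A = A' \<and> B = B'"
    if S: "A \<in> S1" "A' \<in> S1" "B \<in> S2" "B' \<in> S2" and eq: "\<sigma> A B = \<sigma> A' B'" for A A' B B'
  proof -
    define x where "x = g (\<sigma> A B)"
    have "x \<in> A \<inter> B" "x \<in> A' \<inter> B'" using \<sigma>[OF S(1,3)] \<sigma>[OF S(2,4)] eq by (simp_all add: x_def)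
    moreover have "A \<noteq> B" "A' \<noteq> B" "A \<noteq> B'" using S families_disjoint by auto
    then have "A \<noteq> A' \<Longrightarrow> A \<inter> A' \<inter> B = {}" "B \<noteq> B' \<Longrightarrow> A \<inter> B \<inter> B' = {}"
      using S by (simp_all add: no_triple_point)
    ultimately show ?thesis by blast
  qed
  then have "inj_on (case_prod \<sigma>) (S1 \<times> S2)" by (auto simp: inj_on_def)
  then show ?thesis using \<sigma> by (intro exI[of _ "case_prod \<sigma>"]) simp
qed

lemma ex_touching_enumeration:
  assumes G: "separates G S1" and g: "path_image g = G" "pathfinish g = pathstart g"
  defines "N \<equiv> card S1 * card S2"
  obtains r b \<tau> where "strict_mono_on {..<N} \<tau>" "inj_on (\<lambda>t. (r t, b t)) {..<N}"
    "\<forall>t<N. r t \<in> S1 \<and> b t \<in> S2 \<and> 0 \<le> \<tau> t \<and> \<tau> t < 1 \<and> g (\<tau> t) \<in> r t \<inter> b t"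
proof -
  obtain \<sigma> where inj: "inj_on \<sigma> (S1 \<times> S2)" and
    \<sigma>: "\<And>A B. A \<in> S1 \<Longrightarrow> B \<in> S2 \<Longrightarrow> 0 \<le> \<sigma> (A, B) \<and> \<sigma> (A, B) < 1 \<and> g (\<sigma> (A, B)) \<in> A \<inter> B"
    using ex_touching_parameters[OF G g] by blast
  obtain e where e: "bij_betw e {..<N} (S1 \<times> S2)" "strict_mono_on {..<N} (\<sigma> \<circ> e)"
    using ex_strict_mono_enumeration[OF _ inj] finite_families
    unfolding N_def card_cartesian_product[symmetric] by blast
  have curves: "fst (e t) \<in> S1" "snd (e t) \<in> S2" if "t < N" for t
    using bij_betwE[OF e(1)] that by (simp_all add: mem_Times_iff)
  have parameters: "0 \<le> \<sigma> (e t) \<and> \<sigma> (e t) < 1 \<and> g (\<sigma> (e t)) \<in> fst (e t) \<inter> snd (e t)"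
    if "t < N" for t
    using \<sigma>[OF curves[OF that]] by simp
  show thesis
  proof (rule that[of "\<sigma> \<circ> e" "fst \<circ> e" "snd \<circ> e"])
    show "inj_on (\<lambda>t. ((fst \<circ> e) t, (snd \<circ> e) t)) {..<N}"
      using bij_betw_imp_inj_on[OF e(1)] by simp
  qed (use e(2) curves parameters in auto)
qed

lemma intersection_count_ge_of_separates:
  assumes G: "separates G S1" and ne: "S1 \<noteq> {}" "S2 \<noteq> {}"
  defines "N \<equiv> card S1 * card S2"
  shows "real N / 16 * ln (real N / 4) \<le> real (2 * intersection_count S1 + 2 * intersection_count S2
      + 4 * (card S1)\<^sup>2 + 4 * (card S2)\<^sup>2)"
proof -
  have sep: "closed_curve G" "\<Union>S1 \<inter> inside G = {}" "\<And>B. B \<in> S2 \<Longrightarrow> B \<subseteq> disc G"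
    using G by (simp_all add: separates_def)
  have outer: "A \<subseteq> G \<union> outside G" if "A \<in> S1" for A
    using sep(2) that inside_Un_outside[of G] by blast
  obtain g where g: "simple_path g" "pathfinish g = pathstart g" "path_image g = G"
    using closed_curveE[OF sep(1)] .
  obtain r b \<tau> where mono: "strict_mono_on {..<N} \<tau>" and inj: "inj_on (\<lambda>t. (r t, b t)) {..<N}"
    and touching: "\<forall>t<N. r t \<in> S1 \<and> b t \<in> S2 \<and> 0 \<le> \<tau> t \<and> \<tau> t < 1 \<and> g (\<tau> t) \<in> r t \<inter> b t"
    using ex_touching_enumeration[OF G g(3,2)] unfolding N_def .
  have r: "r t \<in> S1" "g (\<tau> t) \<in> r t" and b: "b t \<in> S2" "g (\<tau> t) \<in> b t"
    and \<tau>: "0 \<le> \<tau> t \<and> \<tau> t < 1" if "t < N" for t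
    using touching that by auto
  have off_others: "g (\<tau> t) \<notin> X" if t: "t < N" "X \<in> S1 \<union> S2" "X \<noteq> r t" "X \<noteq> b t" for t X
  proof -
    have "r t \<noteq> b t" using r(1)[OF t(1)] b(1)[OF t(1)] families_disjoint by auto
    then have "X \<inter> r t \<inter> b t = {}"
      using t r(1)[OF t(1)] b(1)[OF t(1)] by (intro no_triple_point) auto
    then show ?thesis using r(2)[OF t(1)] b(2)[OF t(1)] by blast
  qed
  note sum_le = sum_seen_since_le_intersection_count[OF g(1,2) _ mono \<tau>]
  have "(\<Sum>t<N. card (seen_since r t)) \<le> 2 * intersection_count S1 + 4 * (card S1)\<^sup>2"
  proof (rule sum_le)
    show "G \<union> outside G \<in> closed_sides (path_image g)" by (simp add: closed_sides_def g(3))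
    show "g (\<tau> t) \<notin> X" if "t < N" "X \<in> S1" "X \<noteq> r t" for t X
      using off_others[of t X] b(1)[of t] that families_disjoint by auto
  qed (use finite_families general_position_families closed_curves outer r in auto)
  moreover have "(\<Sum>t<N. card (seen_since b t)) \<le> 2 * intersection_count S2 + 4 * (card S2)\<^sup>2"
  proof (rule sum_le)
    show "disc G \<in> closed_sides (path_image g)" by (simp add: closed_sides_def g(3))
    show "g (\<tau> t) \<notin> X" if "t < N" "X \<in> S2" "X \<noteq> b t" for t X
      using off_others[of t X] r(1)[of t] that families_disjoint by auto
  qed (use finite_families general_position_families closed_curves sep(3) b in auto)
  moreover have "N > 0" using finite_families ne by (simp add: N_def card_gt_0_iff)
  then have "real N / 16 * ln (real N / 4)
      \<le> real ((\<Sum>t<N. card (seen_since r t)) + (\<Sum>t<N. card (seen_since b t)))"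
    by (rule sum_seen_since_of_pairs_ge[OF inj])
  ultimately show ?thesis by linarith
qed

lemma ex_two_common_points:
  assumes "card S1 \<ge> 5"
  obtains X Y a b where "X \<in> S1" "Y \<in> S1" "X \<noteq> Y" "a \<in> X \<inter> Y" "b \<in> X \<inter> Y" "a \<noteq> b"
proof -
  have "\<not> pairwise_touching S1"
    using pairwise_touching.card_le_4 finite_families(1) assms by fastforce
  then obtain X Y where XY: "X \<in> S1" "Y \<in> S1" "X \<noteq> Y" "\<nexists>p. X \<inter> Y = {p}"
    using closed_curves general_position_families(1) by (auto simp: pairwise_touching_def)
  moreover obtain a where "a \<in> X \<inter> Y" using meets[of X Y] XY by auto
  moreover from this XY(4) obtain b where "b \<in> X \<inter> Y" "a \<noteq> b" by blast
  ultimately show thesis using that by blast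
qed

lemma touching_families_inversion:
  assumes "z \<notin> \<Union>(S1 \<union> S2)"
  shows "touching_families ((`) (inversion z) ` S1) ((`) (inversion z) ` S2)"
proof
  have Int: "inversion z ` A \<inter> inversion z ` B = inversion z ` (A \<inter> B)" for A B
    by (simp add: image_Int[OF inj_inversion])
  let ?I = "(`) (inversion z)"
  show "finite (?I ` S1)" "finite (?I ` S2)" using finite_families by simp_all
  show "closed_curve A" if "A \<in> ?I ` S1 \<union> ?I ` S2" for A
    using that assms closed_curve_inversion closed_curves by blast
  show "general_position (?I ` S1 \<union> ?I ` S2)"
    using general_position_image[OF inj_inversion gen_pos] by (simp add: image_Un)
  show "A \<inter> B \<noteq> {}" if "A \<in> ?I ` S1 \<union> ?I ` S2" "B \<in> ?I ` S1 \<union> ?I ` S2" for A B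
    using that meets by (auto simp: Int)
  show "\<exists>p. A \<inter> B = {p}" if AB: "A \<in> ?I ` S1" "B \<in> ?I ` S2" for A B
  proof -
    obtain A' B' where A'B': "A' \<in> S1" "A = ?I A'" "B' \<in> S2" "B = ?I B'" using AB by blast
    then obtain p where "A' \<inter> B' = {p}" using meets_once by blast
    then show ?thesis using A'B' Int by auto
  qed
qed

theorem intersection_count_ge:
  assumes "card S1 \<ge> 5" and "S2 \<noteq> {}"
  defines "N \<equiv> card S1 * card S2"
  shows "real N / 16 * ln (real N / 4) \<le> real (2 * intersection_count S1 + 2 * intersection_count S2
      + 4 * (card S1)\<^sup>2 + 4 * (card S2)\<^sup>2)"
proof -
  obtain X Y a b where XY: "X \<in> S1" "Y \<in> S1" "X \<noteq> Y" "a \<in> X \<inter> Y" "b \<in> X \<inter> Y" "a \<noteq> b"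
    using ex_two_common_points[OF assms(1)] .
  then have ne: "S1 \<noteq> {}" by blast
  have X: "closed_curve X" using closed_curves XY(1) by blast
  consider "\<forall>B\<in>S2. B \<subseteq> disc X" | "\<forall>B\<in>S2. B \<subseteq> X \<union> outside X"
    using inseparable_by_closed_curve[OF inseparable_right[OF XY(1)]]
    by (auto simp: closed_sides_def)
  then show ?thesis
  proof cases
    case 1
    then obtain G where "separates G S1" using ex_separating_curve[OF XY] by blast
    then show ?thesis
      unfolding N_def using ne \<open>S2 \<noteq> {}\<close> by (rule intersection_count_ge_of_separates)
  next
    case 2
    have "interior (\<Union>(S1 \<union> S2)) = {}"
      using finite_families closed_curves by (intro interior_Union_closed_curves) auto
    then have "\<not> inside X \<subseteq> \<Union>(S1 \<union> S2)"
      using interior_maximal[OF _ open_inside[OF closed_curve_imp_closed[OF X]]]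
        inside_closed_curve_nonempty[OF X] by blast
    then obtain z where z: "z \<in> inside X" "z \<notin> \<Union>(S1 \<union> S2)" by blast
    let ?I = "(`) (inversion z)"
    interpret inverted: touching_families "?I ` S1" "?I ` S2"
      using z(2) by (rule touching_families_inversion)
    have "inj ?I" using inj_inversion by (simp add: inj_on_image_Pow flip: Pow_UNIV)
    then have card: "card (?I ` S) = card S" for S
      by (simp add: card_image inj_on_subset)
    have "B \<subseteq> disc (?I X)" if "B \<in> ?I ` S2" for B
      using that 2 inversion_outside_subset_inside[OF X z(1)] by blast
    then obtain G where "inverted.separates G (?I ` S1)"
      using inverted.ex_separating_curve[of "?I X" "?I Y" "inversion z a" "inversion z b"] XY
      by (auto simp: inj_eq[OF inj_inversion] inj_eq[OF \<open>inj ?I\<close>])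
    then show ?thesis
      using inverted.intersection_count_ge_of_separates ne \<open>S2 \<noteq> {}\<close>
      by (simp add: card intersection_count_image[OF inj_inversion] N_def)
  qed
qed

end

section \<open>Counting crossings\<close>

lemma general_position_card_containing_le:
  assumes "general_position S"
  shows "card {A \<in> S. p \<in> A} \<le> 2"
proof (rule ccontr)
  assume "\<not> ?thesis"
  then have "3 \<le> card {A \<in> S. p \<in> A}" by simp
  then obtain T where T: "T \<subseteq> {A \<in> S. p \<in> A}" "card T = 3"
    using obtain_subset_with_card_n by metis
  then obtain A B C where "T = {A, B, C}" "A \<noteq> B" "A \<noteq> C" "B \<noteq> C"
    by (auto simp: card_3_iff)
  then show False
    using general_position_no_triple_point[OF assms, of A B C] T(1) by auto
qed

lemma card_Int_le_Suc_card_crossing_points: "card (A \<inter> B) \<le> card (crossing_points A B) + 1"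
proof (cases "touching_points A B = {}")
  case True
  then show ?thesis by (simp add: crossing_points_def)
next
  case False
  then obtain p where "A \<inter> B = {p}" by (auto simp: touching_points_def)
  then show ?thesis by simp
qed

lemma sum_card_crossing_points_le:
  assumes "finite S" and S: "general_position S"
  shows "(\<Sum>A\<in>S. \<Sum>B\<in>S - {A}. card (crossing_points A B)) \<le> 2 * card (crossings S)"
proof -
  have fin: "finite (crossing_points A B)" if "A \<in> S" "B \<in> S - {A}" for A B
    unfolding crossing_points_def using that
    by (intro finite_Diff general_position_finite_Int[OF S]) auto
  then have fin_crossings: "finite (crossings S)"
    using \<open>finite S\<close> by (auto simp: crossings_def)
  have "(\<Sum>A\<in>S. \<Sum>B\<in>S - {A}. card (crossing_points A B)) \<le> (\<Sum>A\<in>S. card {p \<in> crossings S. p \<in> A})"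
  proof (rule sum_mono)
    fix A assume A: "A \<in> S"
    have "crossing_points A B \<inter> crossing_points A C = {}"
      if "B \<in> S - {A}" "C \<in> S - {A}" "B \<noteq> C" for B C
    proof -
      have "A \<inter> B \<inter> C = {}"
        by (rule general_position_no_triple_point[OF S]) (use A that in auto)
      then show ?thesis by (auto simp: crossing_points_def)
    qed
    then have "(\<Sum>B\<in>S - {A}. card (crossing_points A B)) = card (\<Union>B\<in>S - {A}. crossing_points A B)"
      using \<open>finite S\<close> fin[OF A] by (intro card_UN_disjoint[symmetric]) auto
    also have "\<dots> \<le> card {p \<in> crossings S. p \<in> A}"
    proof (rule card_mono)
      show "finite {p \<in> crossings S. p \<in> A}" using fin_crossings by simp
      show "(\<Union>B\<in>S - {A}. crossing_points A B) \<subseteq> {p \<in> crossings S. p \<in> A}"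
        using A by (auto simp: crossings_def crossing_points_def)
    qed
    finally show "(\<Sum>B\<in>S - {A}. card (crossing_points A B)) \<le> card {p \<in> crossings S. p \<in> A}" .
  qed
  also have "\<dots> = (\<Sum>p\<in>crossings S. card {A \<in> S. p \<in> A})"
    using \<open>finite S\<close> fin_crossings by (intro sum_multicount_gen) auto
  also have "\<dots> \<le> (\<Sum>p\<in>crossings S. 2)"
    by (intro sum_mono general_position_card_containing_le S)
  finally show ?thesis by simp
qed

lemma intersection_count_le_crossings:
  assumes "finite S" "general_position S"
  shows "intersection_count S \<le> 2 * card (crossings S) + (card S)\<^sup>2"
proof -
  have "intersection_count S \<le> (\<Sum>A\<in>S. \<Sum>B\<in>S - {A}. card (crossing_points A B) + 1)"
    unfolding intersection_count_def by (intro sum_mono card_Int_le_Suc_card_crossing_points)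
  also have "\<dots> = (\<Sum>A\<in>S. \<Sum>B\<in>S - {A}. card (crossing_points A B)) + (\<Sum>A\<in>S. card (S - {A}))"
    by (simp only: sum.distrib card_eq_sum)
  also have "\<dots> \<le> 2 * card (crossings S) + (\<Sum>A\<in>S. card S)"
    by (intro add_mono sum_card_crossing_points_le assms sum_mono card_Diff1_le)
  finally show ?thesis by (simp add: power2_eq_square)
qed

lemma (in touching_families) ex_many_crossings:
  assumes n: "card S1 = n" "card S2 = n" "n \<ge> 5" and q: "8 * q \<le> ln ((real n)\<^sup>2 / 4) / 16 - 12"
  shows "(real n)\<^sup>2 * q \<le> real (card (crossings S1)) \<or> (real n)\<^sup>2 * q \<le> real (card (crossings S2))"
proof -
  have "(real n)\<^sup>2 * (8 * q) \<le> (real n)\<^sup>2 * (ln ((real n)\<^sup>2 / 4) / 16 - 12)"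
    using q by (intro mult_left_mono) simp_all
  also have "\<dots> = real (n * n) / 16 * ln (real (n * n) / 4) - 12 * (real n)\<^sup>2"
    by (simp add: power2_eq_square algebra_simps)
  also have "\<dots> \<le> real (2 * intersection_count S1 + 2 * intersection_count S2 + 4 * n\<^sup>2 + 4 * n\<^sup>2)
      - 12 * (real n)\<^sup>2"
    using intersection_count_ge n by force
  also have "\<dots> \<le> 4 * real (card (crossings S1)) + 4 * real (card (crossings S2))"
  proof -
    have "real (intersection_count S1) \<le> real (2 * card (crossings S1) + n\<^sup>2)"
      "real (intersection_count S2) \<le> real (2 * card (crossings S2) + n\<^sup>2)"
      using intersection_count_le_crossings[OF finite_families(1) general_position_families(1)]
        intersection_count_le_crossings[OF finite_families(2) general_position_families(2)] n(1,2)
      by (simp_all only: of_nat_le_iff)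
    then show ?thesis by simp
  qed
  finally show ?thesis by linarith
qed

theorem theorem7:
  "\<exists>c::real. c > 0 \<and>
     (\<forall>\<^sub>F n::nat in sequentially. \<forall>S1 S2 :: complex set set.
        finite S1 \<and> finite S2 \<and>
        (\<forall>A \<in> S1 \<union> S2. closed_curve A) \<and>
        general_position (S1 \<union> S2) \<and>
        card S1 = n \<and> card S2 = n \<and>
        (\<forall>A \<in> S1 \<union> S2. \<forall>B \<in> S1 \<union> S2. A \<inter> B \<noteq> {}) \<and>
        (\<forall>A \<in> S1. \<forall>B \<in> S2. touch A B)
        \<longrightarrow>
        real (card (crossings S1)) \<ge> c * (real n)\<^sup>2 * sqrt (ln (real n) / ln (ln (real n))) \<or>
        real (card (crossings S2)) \<ge> c * (real n)\<^sup>2 * sqrt (ln (real n) / ln (ln (real n))))"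
proof (intro exI conjI)
  let "\<exists>c::real. c > 0 \<and> (\<forall>\<^sub>F n in sequentially. \<forall>S1 S2.
      ?families n S1 S2 \<longrightarrow> ?many c n S1 \<or> ?many c n S2)" = ?thesis
  have "\<forall>\<^sub>F n::nat in sequentially.
      8 * sqrt (ln (real n) / ln (ln (real n))) \<le> ln ((real n)\<^sup>2 / 4) / 16 - 12"
    by real_asymp
  with eventually_ge_at_top[of 5]
  show "\<forall>\<^sub>F n in sequentially. \<forall>S1 S2. ?families n S1 S2 \<longrightarrow> ?many 1 n S1 \<or> ?many 1 n S2"
  proof eventually_elim
    case (elim n)
    show ?case
    proof (intro allI impI)
      fix S1 S2 assume families: "?families n S1 S2"
      then interpret touching_families S1 S2
        by unfold_locales (simp_all, unfold touch_def, blast)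
      show "?many 1 n S1 \<or> ?many 1 n S2"
        using ex_many_crossings[of n] families elim by simp
    qed
  qed
qed simp

end
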